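(* Let $\tau$ be a finite $\mathbb F$-stopping time and let $v$ be a làglàd process such that $(v,z,l)$ is a solution on $[\![0,\tau]\!]$ to the RBSDE $$v_t=\xi_\tau-h(\tau,v_{\tau-},\xi_\tau)-\int_{]t,\tau]}f^r_s(v_{s-},v_s,z_s)\,dD^c_s-\sum_{t\le s<\tau}h(s,v_{s-},v_{s+})-\int_{]t,\tau]}z_s\,dM_s+l_\tau-l_t,$$ where $v$ is $\mathbb F$-adapted, $z$ is $\mathbb F$-predictable, and $l$ is a càdlàg, increasing, $\mathbb F$-predictable process with $l_0=0$ obeying the Skorokhod condition $(\mathbf 1_{\{v_-\ne\xi_-\}}\bullet l)_\tau=0$. Then $(y,z,l)$, where $y:=v_+\mathbf 1_{[\![0,\tau]\!]}+h(\tau,v_{\tau-},\xi_\tau)\mathbf 1_{[\![\tau]\!]}$, solves on $[\![0,\tau]\!]$ the càdlàg RBSDE $$y_t=\xi_\tau-\int_{]t,\tau]}f^r_s(y_{s-},y_s,z_s)\,dD^c_s-\sum_{t<s\le\tau}h(s,y_{s-},y_s)-\int_{]t,\tau]}z_s\,dM_s+l_\tau-l_t,$$ where $y$ is càdlàg and $l$ is a càdlàg increasing process such that $(\mathbf 1_{\{y_-\ne\xi_-\}}\bullet l)_\tau=0$ and $l_0=0$.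
   Context: $\mathbb F$ is a filtration satisfying the usual conditions. $M$ is an $\mathbb R^d$-valued $\mathbb F$-local martingale, $D^c$ is the continuous part of a càdlàg $\mathbb F$-adapted process $D^r$ of finite variation, $\xi$ is a given $\mathbb F$-adapted barrier process with left-limit process $\xi_-$ and $\mathcal F_\tau$-measurable terminal value $\xi_\tau$, and $f^r$ and $h$ are given mappings, where $h(s,\cdot,\cdot)=0$ outside the graphs of a finite family of $\mathbb F$-predictable stopping times $(T_i)_{i=1,\dots,p}$. $(H\bullet V)_t:=\int_{]0,t]}H_s\,dV_s$. Làglàd means having left and right limits; $v_+$ is the right-limit process of $v$; solutions are stopped at $\tau$, so that $v_{\tau+}=v_\tau$. A solution of the càdlàg RBSDE is a triplet $(y,z,l)$ with $y$ $\mathbb F$-optional, $z$ $\mathbb R^d$-valued $\mathbb F$-predictable, and $l$ $\mathbb F$-predictable, with the properties listed in the claim. *)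

theory Defs
  imports "HOL-Probability.Probability"
begin

text \<open>
  Processes are functions \<open>X t \<omega>\<close> with real time \<open>t\<close>, of which only \<open>t \<ge> 0\<close> matters. Filtrations
  are indexed by \<open>ennreal\<close>, so that stopping times may be infinite; \<open>F \<infinity>\<close> is any
  sub-sigma-algebra containing all \<open>F t\<close>.
\<close>

section \<open>Path properties\<close>

definition right_cont :: "(real \<Rightarrow> 'b::topological_space) \<Rightarrow> bool" where
  "right_cont g \<longleftrightarrow> (\<forall>t\<ge>0. (g \<longlongrightarrow> g t) (at_right t))"

definition has_right_limits :: "(real \<Rightarrow> 'b::topological_space) \<Rightarrow> bool" where
  "has_right_limits g \<longleftrightarrow> (\<forall>t\<ge>0. \<exists>a. (g \<longlongrightarrow> a) (at_right t))"

definition has_left_limits :: "(real \<Rightarrow> 'b::topological_space) \<Rightarrow> bool" where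
  "has_left_limits g \<longleftrightarrow> (\<forall>t>0. \<exists>a. (g \<longlongrightarrow> a) (at_left t))"

definition cadlag :: "(real \<Rightarrow> 'b::topological_space) \<Rightarrow> bool" where
  "cadlag g \<longleftrightarrow> right_cont g \<and> has_left_limits g"

definition laglad :: "(real \<Rightarrow> 'b::topological_space) \<Rightarrow> bool" where
  "laglad g \<longleftrightarrow> has_right_limits g \<and> has_left_limits g"

text \<open>The convention at time zero is \<open>g(0-) = g(0)\<close>.\<close>

definition left_lim :: "(real \<Rightarrow> 'b::t2_space) \<Rightarrow> real \<Rightarrow> 'b" where
  "left_lim g t = (if t > 0 then Lim (at_left t) g else g t)"

definition right_lim :: "(real \<Rightarrow> 'b::t2_space) \<Rightarrow> real \<Rightarrow> 'b" where
  "right_lim g t = Lim (at_right t) g"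

definition variation_sums :: "(real \<Rightarrow> real) \<Rightarrow> real \<Rightarrow> real set" where
  "variation_sums g t =
     {\<Sum>k<n. \<bar>g (p (Suc k)) - g (p k)\<bar> | n p. incseq p \<and> range p \<subseteq> {0..t}}"

definition finite_variation :: "(real \<Rightarrow> real) \<Rightarrow> bool" where
  "finite_variation g \<longleftrightarrow> (\<forall>t\<ge>0. bdd_above (variation_sums g t))"

definition total_variation :: "(real \<Rightarrow> real) \<Rightarrow> real \<Rightarrow> real" where
  "total_variation g t = Sup (variation_sums g t)"

section \<open>Pathwise Lebesgue--Stieltjes integration\<close>

text \<open>
  The measures on the real line given by the Jordan decomposition of a right-continuous function
  of finite variation; \<open>max 0 t\<close> extends it to negative times by a constant.
\<close>

definition pos_variation_measure :: "(real \<Rightarrow> real) \<Rightarrow> real measure" where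
  "pos_variation_measure g = interval_measure
     (\<lambda>t. (total_variation g (max 0 t) + (g (max 0 t) - g 0)) / 2)"

definition neg_variation_measure :: "(real \<Rightarrow> real) \<Rightarrow> real measure" where
  "neg_variation_measure g = interval_measure
     (\<lambda>t. (total_variation g (max 0 t) - (g (max 0 t) - g 0)) / 2)"

definition stieltjes_integrable :: "(real \<Rightarrow> real) \<Rightarrow> (real \<Rightarrow> real) \<Rightarrow> real \<Rightarrow> real \<Rightarrow> bool" where
  "stieltjes_integrable g H a b \<longleftrightarrow>
     set_integrable (pos_variation_measure g) {a<..b} H \<and>
     set_integrable (neg_variation_measure g) {a<..b} H"

text \<open>The integral of \<open>H dg\<close> over \<open>]a, b]\<close>.\<close>

definition stieltjes_integral :: "(real \<Rightarrow> real) \<Rightarrow> (real \<Rightarrow> real) \<Rightarrow> real \<Rightarrow> real \<Rightarrow> real" where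
  "stieltjes_integral g H a b =
     (LINT s:{a<..b}|pos_variation_measure g. H s) -
     (LINT s:{a<..b}|neg_variation_measure g. H s)"

definition continuous_part :: "(real \<Rightarrow> real) \<Rightarrow> real \<Rightarrow> real" where
  "continuous_part g t = g t - (\<Sum>\<^sub>\<infinity>s\<in>{0<..t}. g s - left_lim g s)"

section \<open>Filtrations and measurability of processes\<close>

definition usual_conditions :: "'a measure \<Rightarrow> (ennreal \<Rightarrow> 'a measure) \<Rightarrow> bool" where
  "usual_conditions \<mu> F \<longleftrightarrow>
     (\<forall>t<\<infinity>. sets (F t) = (\<Inter>s\<in>{t<..}. sets (F s))) \<and>
     (\<forall>A\<in>null_sets \<mu>. \<forall>B\<subseteq>A. B \<in> sets (F 0))"

definition adapted :: "(ennreal \<Rightarrow> 'a measure) \<Rightarrow> (real \<Rightarrow> 'a \<Rightarrow> 'b::topological_space) \<Rightarrow> bool" where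
  "adapted F X \<longleftrightarrow> (\<forall>t\<ge>0. X t \<in> borel_measurable (F (ennreal t)))"

definition optional_sigma :: "'a measure \<Rightarrow> (ennreal \<Rightarrow> 'a measure) \<Rightarrow> (real \<times> 'a) measure" where
  "optional_sigma \<mu> F = sigma ({0..} \<times> space \<mu>)
     {{(t, \<omega>). t \<ge> 0 \<and> \<omega> \<in> space \<mu> \<and> X t \<omega> \<in> B} | (X :: real \<Rightarrow> 'a \<Rightarrow> real) B.
        adapted F X \<and> (\<forall>\<omega>\<in>space \<mu>. cadlag (\<lambda>t. X t \<omega>)) \<and> B \<in> sets borel}"

definition predictable_sigma :: "'a measure \<Rightarrow> (ennreal \<Rightarrow> 'a measure) \<Rightarrow> (real \<times> 'a) measure" where
  "predictable_sigma \<mu> F = sigma ({0..} \<times> space \<mu>)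
     ({{0} \<times> A | A. A \<in> sets (F 0)} \<union>
      {{s<..t} \<times> A | s t A. 0 \<le> s \<and> s \<le> t \<and> A \<in> sets (F (ennreal s))})"

definition optional ::
  "'a measure \<Rightarrow> (ennreal \<Rightarrow> 'a measure) \<Rightarrow> (real \<Rightarrow> 'a \<Rightarrow> 'b::topological_space) \<Rightarrow> bool" where
  "optional \<mu> F X \<longleftrightarrow> (\<lambda>(t, \<omega>). X t \<omega>) \<in> borel_measurable (optional_sigma \<mu> F)"

definition predictable ::
  "'a measure \<Rightarrow> (ennreal \<Rightarrow> 'a measure) \<Rightarrow> (real \<Rightarrow> 'a \<Rightarrow> 'b::topological_space) \<Rightarrow> bool" where
  "predictable \<mu> F X \<longleftrightarrow> (\<lambda>(t, \<omega>). X t \<omega>) \<in> borel_measurable (predictable_sigma \<mu> F)"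

text \<open>A stopping time \<open>T\<close> is predictable if the stochastic interval \<open>[[0, T[[\<close> is.\<close>

definition predictable_time ::
  "'a measure \<Rightarrow> (ennreal \<Rightarrow> 'a measure) \<Rightarrow> ('a \<Rightarrow> ennreal) \<Rightarrow> bool" where
  "predictable_time \<mu> F T \<longleftrightarrow> stopping_time F T \<and>
     {(t, \<omega>). t \<ge> 0 \<and> \<omega> \<in> space \<mu> \<and> ennreal t < T \<omega>} \<in> sets (predictable_sigma \<mu> F)"

definition stopped :: "('a \<Rightarrow> ennreal) \<Rightarrow> (real \<Rightarrow> 'a \<Rightarrow> 'b) \<Rightarrow> real \<Rightarrow> 'a \<Rightarrow> 'b" where
  "stopped T X t \<omega> = X (enn2real (min (ennreal t) (T \<omega>))) \<omega>"

definition is_stopped_at :: "'a measure \<Rightarrow> ('a \<Rightarrow> real) \<Rightarrow> (real \<Rightarrow> 'a \<Rightarrow> 'b) \<Rightarrow> bool" where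
  "is_stopped_at \<mu> \<tau> X \<longleftrightarrow> (\<forall>\<omega>\<in>space \<mu>. \<forall>t\<ge>\<tau> \<omega>. X t \<omega> = X (\<tau> \<omega>) \<omega>)"

section \<open>Local martingales and stochastic integrals\<close>

definition martingale ::
  "'a measure \<Rightarrow> (ennreal \<Rightarrow> 'a measure) \<Rightarrow> (real \<Rightarrow> 'a \<Rightarrow> real) \<Rightarrow> bool" where
  "martingale \<mu> F X \<longleftrightarrow> adapted F X \<and> (\<forall>t\<ge>0. integrable \<mu> (X t)) \<and>
     (\<forall>s t. 0 \<le> s \<and> s \<le> t \<longrightarrow> (AE \<omega> in \<mu>. real_cond_exp \<mu> (F (ennreal s)) (X t) \<omega> = X s \<omega>))"

text \<open>The indicator of \<open>S n > 0\<close> avoids any integrability requirement on the initial value.\<close>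

definition local_martingale ::
  "'a measure \<Rightarrow> (ennreal \<Rightarrow> 'a measure) \<Rightarrow> (real \<Rightarrow> 'a \<Rightarrow> real) \<Rightarrow> bool" where
  "local_martingale \<mu> F X \<longleftrightarrow> adapted F X \<and> (\<forall>\<omega>\<in>space \<mu>. cadlag (\<lambda>t. X t \<omega>)) \<and>
     (\<exists>S :: nat \<Rightarrow> 'a \<Rightarrow> ennreal. (\<forall>n. stopping_time F (S n)) \<and>
        (AE \<omega> in \<mu>. incseq (\<lambda>n. S n \<omega>) \<and> (\<lambda>n. S n \<omega>) \<longlonglongrightarrow> \<infinity>) \<and>
        (\<forall>n. martingale \<mu> F (\<lambda>t \<omega>. stopped (S n) X t \<omega> * indicator {\<omega>. S n \<omega> > 0} \<omega>)))"

definition vector_local_martingale ::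
  "'a measure \<Rightarrow> (ennreal \<Rightarrow> 'a measure) \<Rightarrow> (real \<Rightarrow> 'a \<Rightarrow> real ^ 'd) \<Rightarrow> bool" where
  "vector_local_martingale \<mu> F M \<longleftrightarrow> (\<forall>i. local_martingale \<mu> F (\<lambda>t \<omega>. M t \<omega> $ i))"

text \<open>
  \<open>Q\<close> is a version of the quadratic covariation \<open>[X, Y]\<close> (started at zero): the limit in
  probability of the sums of products of increments along the dyadic partitions.
\<close>

definition dyadic_covariation ::
  "(real \<Rightarrow> 'a \<Rightarrow> real) \<Rightarrow> (real \<Rightarrow> 'a \<Rightarrow> real) \<Rightarrow> nat \<Rightarrow> real \<Rightarrow> 'a \<Rightarrow> real" where
  "dyadic_covariation X Y n t \<omega> =
     (\<Sum>k < nat \<lceil>t * 2 ^ n\<rceil>.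
        (X (min t (real (Suc k) / 2 ^ n)) \<omega> - X (real k / 2 ^ n) \<omega>) *
        (Y (min t (real (Suc k) / 2 ^ n)) \<omega> - Y (real k / 2 ^ n) \<omega>))"

definition covariation ::
  "'a measure \<Rightarrow> (ennreal \<Rightarrow> 'a measure) \<Rightarrow> (real \<Rightarrow> 'a \<Rightarrow> real) \<Rightarrow> (real \<Rightarrow> 'a \<Rightarrow> real) \<Rightarrow>
     (real \<Rightarrow> 'a \<Rightarrow> real) \<Rightarrow> bool" where
  "covariation \<mu> F X Y Q \<longleftrightarrow> adapted F Q \<and>
     (\<forall>\<omega>\<in>space \<mu>. cadlag (\<lambda>t. Q t \<omega>) \<and> finite_variation (\<lambda>t. Q t \<omega>)) \<and>
     (\<forall>t\<ge>0. \<forall>\<epsilon>>0. (\<lambda>n. measure \<mu> {\<omega>\<in>space \<mu>. \<bar>dyadic_covariation X Y n t \<omega> - Q t \<omega>\<bar> > \<epsilon>})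
        \<longlonglongrightarrow> 0)"

text \<open>
  \<open>N\<close> is the stochastic integral of the \<open>\<real>\<^sup>d\<close>-valued integrand \<open>z\<close> with respect to the local
  martingale \<open>M\<close>: the local martingale null at zero with \<open>d[N, L] = \<Sum>\<^sub>i z\<^sup>i d[M\<^sup>i, L]\<close> for every
  local martingale \<open>L\<close>. For unbounded \<open>z\<close> the single terms need not be integrable (vector
  stochastic integral), so the identity of measures is required on each set \<open>\<bar>z\<bar> \<le> n\<close>; these sets
  exhaust the time axis, hence \<open>[N, L]\<close>, and thereby \<open>N\<close> up to indistinguishability, is determined.
  The existence of \<open>N\<close> is the integrability of \<open>z\<close> with respect to \<open>M\<close>.
\<close>

definition stochastic_integral ::
  "'a measure \<Rightarrow> (ennreal \<Rightarrow> 'a measure) \<Rightarrow> (real \<Rightarrow> 'a \<Rightarrow> real ^ 'd) \<Rightarrow>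
     (real \<Rightarrow> 'a \<Rightarrow> real ^ 'd) \<Rightarrow> (real \<Rightarrow> 'a \<Rightarrow> real) \<Rightarrow> bool" where
  "stochastic_integral \<mu> F z M N \<longleftrightarrow>
     predictable \<mu> F z \<and> local_martingale \<mu> F N \<and> (\<forall>\<omega>\<in>space \<mu>. N 0 \<omega> = 0) \<and>
     (\<forall>L. local_martingale \<mu> F L \<longrightarrow>
        (\<exists>Q R. covariation \<mu> F N L Q \<and> (\<forall>i. covariation \<mu> F (\<lambda>t \<omega>. M t \<omega> $ i) L (R i)) \<and>
           (AE \<omega> in \<mu>. \<forall>n. \<forall>t\<ge>0.
              stieltjes_integral (\<lambda>s. Q s \<omega>) (\<lambda>s. if norm (z s \<omega>) \<le> real n then 1 else 0) 0 t =
              (\<Sum>i\<in>UNIV. stieltjes_integral (\<lambda>s. R i s \<omega>)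
                 (\<lambda>s. if norm (z s \<omega>) \<le> real n then z s \<omega> $ i else 0) 0 t))))"

section \<open>Solutions of the reflected equations\<close>

text \<open>
  Solutions on \<open>[[0, \<tau>]]\<close> are processes stopped at \<open>\<tau>\<close>; the integrand \<open>z\<close> only enters through its
  restriction to \<open>[[0, \<tau>]]\<close>. The sums of \<open>h\<close> are sums over uncountable intervals, but have only
  finitely many nonzero terms when \<open>h\<close> is supported by finitely many graphs. Well-definedness of
  the integrals is part of the notion of a solution.
\<close>

definition reflection_process ::
  "'a measure \<Rightarrow> (ennreal \<Rightarrow> 'a measure) \<Rightarrow> ('a \<Rightarrow> real) \<Rightarrow> (real \<Rightarrow> 'a \<Rightarrow> real) \<Rightarrow>
     (real \<Rightarrow> 'a \<Rightarrow> real) \<Rightarrow> (real \<Rightarrow> 'a \<Rightarrow> real) \<Rightarrow> bool" where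
  "reflection_process \<mu> F \<tau> \<xi> y l \<longleftrightarrow>
     predictable \<mu> F l \<and> is_stopped_at \<mu> \<tau> l \<and>
     (\<forall>\<omega>\<in>space \<mu>. cadlag (\<lambda>t. l t \<omega>) \<and> mono_on {0..} (\<lambda>t. l t \<omega>) \<and> l 0 \<omega> = 0) \<and>
     (AE \<omega> in \<mu>. stieltjes_integral (\<lambda>t. l t \<omega>)
        (indicator {s. left_lim (\<lambda>t. y t \<omega>) s \<noteq> left_lim (\<lambda>t. \<xi> t \<omega>) s}) 0 (\<tau> \<omega>) = 0)"

definition laglad_rbsde_solution ::
  "'a measure \<Rightarrow> (ennreal \<Rightarrow> 'a measure) \<Rightarrow> ('a \<Rightarrow> real) \<Rightarrow> (real \<Rightarrow> 'a \<Rightarrow> real) \<Rightarrow>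
     (real \<Rightarrow> 'a \<Rightarrow> real \<Rightarrow> real \<Rightarrow> real ^ 'd \<Rightarrow> real) \<Rightarrow> (real \<Rightarrow> 'a \<Rightarrow> real \<Rightarrow> real \<Rightarrow> real) \<Rightarrow>
     (real \<Rightarrow> 'a \<Rightarrow> real) \<Rightarrow> (real \<Rightarrow> 'a \<Rightarrow> real ^ 'd) \<Rightarrow>
     (real \<Rightarrow> 'a \<Rightarrow> real) \<Rightarrow> (real \<Rightarrow> 'a \<Rightarrow> real ^ 'd) \<Rightarrow> (real \<Rightarrow> 'a \<Rightarrow> real) \<Rightarrow> bool" where
  "laglad_rbsde_solution \<mu> F \<tau> \<xi> f h Dc M v z l \<longleftrightarrow>
     adapted F v \<and> (\<forall>\<omega>\<in>space \<mu>. laglad (\<lambda>t. v t \<omega>)) \<and> is_stopped_at \<mu> \<tau> v \<and>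
     predictable \<mu> F z \<and> reflection_process \<mu> F \<tau> \<xi> v l \<and>
     (AE \<omega> in \<mu>. stieltjes_integrable (\<lambda>t. Dc t \<omega>)
        (\<lambda>s. f s \<omega> (left_lim (\<lambda>u. v u \<omega>) s) (v s \<omega>) (z s \<omega>)) 0 (\<tau> \<omega>)) \<and>
     (\<exists>N. stochastic_integral \<mu> F (\<lambda>t \<omega>. if t \<le> \<tau> \<omega> then z t \<omega> else 0) M N \<and>
        (AE \<omega> in \<mu>. \<forall>t\<in>{0..\<tau> \<omega>}.
           v t \<omega> = \<xi> (\<tau> \<omega>) \<omega> - h (\<tau> \<omega>) \<omega> (left_lim (\<lambda>u. v u \<omega>) (\<tau> \<omega>)) (\<xi> (\<tau> \<omega>) \<omega>)
             - stieltjes_integral (\<lambda>u. Dc u \<omega>)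
                 (\<lambda>s. f s \<omega> (left_lim (\<lambda>u. v u \<omega>) s) (v s \<omega>) (z s \<omega>)) t (\<tau> \<omega>)
             - (\<Sum>\<^sub>\<infinity>s\<in>{t..<\<tau> \<omega>}.
                 h s \<omega> (left_lim (\<lambda>u. v u \<omega>) s) (right_lim (\<lambda>u. v u \<omega>) s))
             - (N (\<tau> \<omega>) \<omega> - N t \<omega>) + l (\<tau> \<omega>) \<omega> - l t \<omega>))"

definition cadlag_rbsde_solution ::
  "'a measure \<Rightarrow> (ennreal \<Rightarrow> 'a measure) \<Rightarrow> ('a \<Rightarrow> real) \<Rightarrow> (real \<Rightarrow> 'a \<Rightarrow> real) \<Rightarrow>
     (real \<Rightarrow> 'a \<Rightarrow> real \<Rightarrow> real \<Rightarrow> real ^ 'd \<Rightarrow> real) \<Rightarrow> (real \<Rightarrow> 'a \<Rightarrow> real \<Rightarrow> real \<Rightarrow> real) \<Rightarrow>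
     (real \<Rightarrow> 'a \<Rightarrow> real) \<Rightarrow> (real \<Rightarrow> 'a \<Rightarrow> real ^ 'd) \<Rightarrow>
     (real \<Rightarrow> 'a \<Rightarrow> real) \<Rightarrow> (real \<Rightarrow> 'a \<Rightarrow> real ^ 'd) \<Rightarrow> (real \<Rightarrow> 'a \<Rightarrow> real) \<Rightarrow> bool" where
  "cadlag_rbsde_solution \<mu> F \<tau> \<xi> f h Dc M y z l \<longleftrightarrow>
     optional \<mu> F y \<and> (\<forall>\<omega>\<in>space \<mu>. cadlag (\<lambda>t. y t \<omega>)) \<and> is_stopped_at \<mu> \<tau> y \<and>
     predictable \<mu> F z \<and> reflection_process \<mu> F \<tau> \<xi> y l \<and>
     (AE \<omega> in \<mu>. stieltjes_integrable (\<lambda>t. Dc t \<omega>)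
        (\<lambda>s. f s \<omega> (left_lim (\<lambda>u. y u \<omega>) s) (y s \<omega>) (z s \<omega>)) 0 (\<tau> \<omega>)) \<and>
     (\<exists>N. stochastic_integral \<mu> F (\<lambda>t \<omega>. if t \<le> \<tau> \<omega> then z t \<omega> else 0) M N \<and>
        (AE \<omega> in \<mu>. \<forall>t\<in>{0..\<tau> \<omega>}.
           y t \<omega> = \<xi> (\<tau> \<omega>) \<omega>
             - stieltjes_integral (\<lambda>u. Dc u \<omega>)
                 (\<lambda>s. f s \<omega> (left_lim (\<lambda>u. y u \<omega>) s) (y s \<omega>) (z s \<omega>)) t (\<tau> \<omega>)
             - (\<Sum>\<^sub>\<infinity>s\<in>{t<..\<tau> \<omega>}. h s \<omega> (left_lim (\<lambda>u. y u \<omega>) s) (y s \<omega>))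
             - (N (\<tau> \<omega>) \<omega> - N t \<omega>) + l (\<tau> \<omega>) \<omega> - l t \<omega>))"

end

(*
  Along a path, y is the right limit of v before tau and v_tau + h(tau, v_{tau-}, xi_tau) from tau
  on; taking t = tau in the equation for v shows that the latter is xi_tau almost surely. Letting
  s decrease to t in the equation for v_s removes exactly the term s = t from the sum of h, because
  h has finite support in time and the other terms are right-continuous. Hence y and v differ at
  most at tau and at the finitely many times T_i. These are null sets for D^c, whose total
  variation is continuous, so the driver integral does not change; the Skorokhod condition is
  unaffected since y and v have the same left limits.

  As h is a mere mapping, y is adapted only because its value from tau on agrees almost surely with
  xi_tau and the filtration is complete.
*)
theory Submission
  imports Defs
begin

section \<open>Total variation\<close>

lemma variation_sums_le_total_variation:
  assumes "finite_variation g" "0 \<le> t" "x \<in> variation_sums g t"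
  shows "x \<le> total_variation g t"
  using assms unfolding total_variation_def finite_variation_def by (auto intro!: cSup_upper)

lemma zero_in_variation_sums:
  assumes "0 \<le> t"
  shows "0 \<in> variation_sums g t"
  unfolding variation_sums_def using assms
  by (intro CollectI exI[of _ 0] exI[of _ "\<lambda>_. 0"]) (auto simp: incseq_def)

lemma total_variation_nonneg:
  assumes "finite_variation g" "0 \<le> t"
  shows "0 \<le> total_variation g t"
  using variation_sums_le_total_variation[OF assms zero_in_variation_sums[OF assms(2)]] .

text \<open>Appending \<open>a\<close> and \<open>b\<close> to a partition of [0, a] gives a
  partition of [0, b] that has the increment from \<open>a\<close> to \<open>b\<close> in
  addition.\<close>

lemma total_variation_increment:
  assumes g: "finite_variation g" and "0 \<le> a" "a \<le> b"
  shows "\<bar>g b - g a\<bar> \<le> total_variation g b - total_variation g a"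
proof -
  have "x \<le> total_variation g b - \<bar>g b - g a\<bar>" if "x \<in> variation_sums g a" for x
  proof -
    from that obtain n q where x: "x = (\<Sum>k<n. \<bar>g (q (Suc k)) - g (q k)\<bar>)"
      and q: "incseq q" "range q \<subseteq> {0..a}"
      unfolding variation_sums_def by blast
    \<comment> \<open>Partitions are infinite sequences of which an initial segment counts, so
      \<open>r\<close> stays at \<open>b\<close> after its new points. The extra step from
      \<open>q n\<close> to \<open>a\<close> only adds a nonnegative term.\<close>
    define r where "r k = (if k \<le> n then q k else if k = Suc n then a else b)" for k
    have q_le: "0 \<le> q k" "q k \<le> a" for k using subsetD[OF q(2), of "q k"] by auto
    have "incseq r"
      unfolding incseq_Suc_iff r_def using incseqD[OF q(1)] q_le(2) \<open>a \<le> b\<close> by auto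
    moreover have "range r \<subseteq> {0..b}"
      using q_le order_trans[OF q_le(2) \<open>a \<le> b\<close>] \<open>0 \<le> a\<close> \<open>a \<le> b\<close> by (auto simp: r_def)
    ultimately have "(\<Sum>k<Suc (Suc n). \<bar>g (r (Suc k)) - g (r k)\<bar>) \<in> variation_sums g b"
      unfolding variation_sums_def by blast
    then have "(\<Sum>k<Suc (Suc n). \<bar>g (r (Suc k)) - g (r k)\<bar>) \<le> total_variation g b"
      using variation_sums_le_total_variation[OF g] \<open>0 \<le> a\<close> \<open>a \<le> b\<close> by simp
    moreover have "(\<Sum>k<n. \<bar>g (r (Suc k)) - g (r k)\<bar>) = x"
      unfolding x by (intro sum.cong) (auto simp: r_def)
    ultimately show ?thesis by (auto simp: r_def)
  qed
  then have "Sup (variation_sums g a) \<le> total_variation g b - \<bar>g b - g a\<bar>"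
    using zero_in_variation_sums[OF \<open>0 \<le> a\<close>] by (intro cSup_least) auto
  then show ?thesis by (simp add: total_variation_def)
qed

text \<open>Telescoping. The set \<open>A\<close> allows a function \<open>W\<close> that dominates
  the increments of \<open>g\<close> only between certain times; \<open>total_variation_gap\<close>
  cuts an open interval out of the time axis.\<close>

lemma variation_le_increment:
  fixes g W :: "real \<Rightarrow> real"
  assumes le: "\<And>a b. a \<in> A \<Longrightarrow> b \<in> A \<Longrightarrow> a \<le> b \<Longrightarrow> \<bar>g b - g a\<bar> \<le> W b - W a"
    and "incseq p" "p ` {..n} \<subseteq> A"
  shows "(\<Sum>k<n. \<bar>g (p (Suc k)) - g (p k)\<bar>) \<le> W (p n) - W (p 0)"
proof -
  have "(\<Sum>k<n. \<bar>g (p (Suc k)) - g (p k)\<bar>) \<le> (\<Sum>k<n. W (p (Suc k)) - W (p k))"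
    using assms(2,3) by (intro sum_mono le) (auto simp: incseq_Suc_iff)
  also have "\<dots> = W (p n) - W (p 0)" by (rule sum_lessThan_telescope)
  finally show ?thesis .
qed

lemma finite_variationI:
  assumes "\<And>a b. 0 \<le> a \<Longrightarrow> a \<le> b \<Longrightarrow> \<bar>g b - g a\<bar> \<le> W b - W a"
  shows "finite_variation g"
  unfolding finite_variation_def
proof (intro allI impI bdd_aboveI)
  fix t x :: real assume "0 \<le> t" "x \<in> variation_sums g t"
  then obtain n p where x: "x = (\<Sum>k<n. \<bar>g (p (Suc k)) - g (p k)\<bar>)"
    and p: "incseq p" "range p \<subseteq> {0..t}"
    unfolding variation_sums_def by blast
  have "x \<le> W (p n) - W (p 0)"
    unfolding x using p by (intro variation_le_increment[where A = "{0..t}"] assms) auto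
  moreover have "0 \<le> p 0" "p n \<le> t" using subsetD[OF p(2), of "p _"] by auto
  ultimately show "x \<le> W t - W 0"
    using assms[of 0 "p 0"] assms[of "p n" t] incseqD[OF p(1), of 0 n] by linarith
qed

text \<open>
  The partition nearly attains the variation on \<open>[0, K]\<close>; adding \<open>a\<close> and \<open>b\<close> to it
  shows that little variation is left for \<open>[a, b]\<close> beyond the increment.
\<close>

lemma total_variation_gap:
  assumes g: "finite_variation g" and "0 \<le> a" "a \<le> b" "b \<le> K"
    and p: "incseq p" "range p \<subseteq> {0..K}"
    and n: "total_variation g K - \<epsilon> < (\<Sum>k<n. \<bar>g (p (Suc k)) - g (p k)\<bar>)"
    and gap: "\<And>k. k \<le> n \<Longrightarrow> p k \<notin> {a<..<b}"
  shows "total_variation g b - total_variation g a < \<bar>g b - g a\<bar> + \<epsilon>"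
proof -
  let ?V = "total_variation g"
  \<comment> \<open>\<open>W\<close> is the total variation with its growth from \<open>a\<close> to
    \<open>b\<close> replaced by \<open>\<bar>g b - g a\<bar>\<close>. Between points outside the
    gap it still dominates the increments of \<open>g\<close>, so it bounds the nearly optimal
    partition sum. This forces the growth that was replaced to exceed its replacement by less than
    \<epsilon>.\<close>
  define W where "W x = (if x \<le> a then ?V x else ?V a + \<bar>g b - g a\<bar> + (?V x - ?V b))" for x
  have W: "\<bar>g y - g x\<bar> \<le> W y - W x"
    if "x \<in> {0..K} - {a<..<b}" "y \<in> {0..K} - {a<..<b}" "x \<le> y" for x y
  proof -
    have "x \<le> a \<or> b \<le> x" "y \<le> a \<or> b \<le> y" using that by auto
    then consider "y \<le> a" | "x \<le> a" "b \<le> y" "a < y" | "b \<le> x" "a < x" by fastforce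
    then show ?thesis
    proof cases
      case 1 then show ?thesis using that total_variation_increment[OF g, of x y] by (auto simp: W_def)
    next
      case 2
      then show ?thesis
        using that \<open>0 \<le> a\<close> \<open>a \<le> b\<close> total_variation_increment[OF g, of x a]
          total_variation_increment[OF g, of b y] by (auto simp: W_def)
    next
      case 3 then show ?thesis using that \<open>0 \<le> a\<close> \<open>a \<le> b\<close> total_variation_increment[OF g, of x y]
        by (auto simp: W_def)
    qed
  qed
  have "(\<Sum>k<n. \<bar>g (p (Suc k)) - g (p k)\<bar>) \<le> W (p n) - W (p 0)"
    using p gap by (intro variation_le_increment[where A = "{0..K} - {a<..<b}"] W) auto
  moreover have "W (p n) \<le> W K" "W 0 \<le> W (p 0)"
    using p(2) gap[of n] gap[of 0] \<open>0 \<le> a\<close> \<open>a \<le> b\<close> \<open>b \<le> K\<close> W[of "p n" K] W[of 0 "p 0"]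
    by (auto simp: subset_iff)
  moreover have "0 \<le> W 0" using total_variation_nonneg[OF g] \<open>0 \<le> a\<close> by (simp add: W_def)
  moreover have "W K \<le> ?V a + \<bar>g b - g a\<bar> + (?V K - ?V b)"
  proof (cases "K \<le> a")
    case True
    then have "b = a" "K = a" using \<open>a \<le> b\<close> \<open>b \<le> K\<close> by auto
    then show ?thesis by (simp add: W_def)
  qed (simp add: W_def)
  ultimately show ?thesis using n by linarith
qed

lemma total_variation_approx:
  assumes "finite_variation g" "0 \<le> K" "0 < \<epsilon>"
  obtains n p where "incseq p" "range p \<subseteq> {0..K}"
    "total_variation g K - \<epsilon> < (\<Sum>k<n. \<bar>g (p (Suc k)) - g (p k)\<bar>)"
proof -
  have "\<exists>x\<in>variation_sums g K. total_variation g K - \<epsilon> < x"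
    unfolding total_variation_def using zero_in_variation_sums[OF assms(2)] assms
    by (intro less_cSupD) auto
  then show thesis using that unfolding variation_sums_def by blast
qed

text \<open>A nearly optimal partition has only finitely many relevant points, so none of them lies
  strictly between \<open>s\<close> and \<open>t\<close> once \<open>s\<close> is close to
  \<open>t\<close> on the side given by \<open>F\<close>. Then \<open>total_variation_gap\<close>
  bounds the variation between them by the increment of \<open>g\<close> plus \<epsilon>/2.\<close>

lemma total_variation_tendsto:
  assumes g: "finite_variation g" and "0 \<le> t" and F: "F = at_right t \<or> F = at_left t \<and> 0 < t"
    and lim: "(g \<longlongrightarrow> g t) F"
  shows "(total_variation g \<longlongrightarrow> total_variation g t) F"
proof (rule tendstoI)
  fix \<epsilon> :: real assume "0 < \<epsilon>"
  \<comment> \<open>The horizon \<open>t + 1\<close> leaves room on the right of \<open>t\<close>,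
    so that one partition serves both choices of \<open>F\<close>.\<close>
  have "0 \<le> t + 1" "0 < \<epsilon> / 2" using \<open>0 < \<epsilon>\<close> \<open>0 \<le> t\<close> by auto
  from total_variation_approx[OF g this] obtain n p where p: "incseq p" "range p \<subseteq> {0..t + 1}"
    "total_variation g (t + 1) - \<epsilon> / 2 < (\<Sum>k<n. \<bar>g (p (Suc k)) - g (p k)\<bar>)" .
  have close: "\<forall>\<^sub>F s in F. \<bar>g s - g t\<bar> < \<epsilon> / 2"
    using tendstoD[OF lim, of "\<epsilon> / 2"] \<open>0 < \<epsilon>\<close> by (simp add: dist_real_def)
  \<comment> \<open>The time \<open>t\<close> may itself be a partition point; this is harmless
    because the gap between \<open>s\<close> and \<open>t\<close> is open.\<close>
  obtain d where d: "0 < d" "\<forall>x\<in>p ` {..n}. x \<noteq> t \<longrightarrow> d \<le> dist t x"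
    using finite_set_avoid[of "p ` {..n}" t] by auto
  have "\<forall>\<^sub>F s in F. 0 \<le> s \<and> s \<le> t + 1 \<and> s \<noteq> t \<and> dist s t < d"
  proof (cases "F = at_right t")
    case True
    have "\<forall>\<^sub>F s in at_right t. s \<in> {t<..<t + min 1 d}"
      using \<open>0 < d\<close> by (intro eventually_at_right_real) auto
    then show ?thesis unfolding True
      by (rule eventually_mono) (use \<open>0 \<le> t\<close> in \<open>auto simp: dist_real_def\<close>)
  next
    case False
    with F have F: "F = at_left t" "0 < t" by auto
    have "\<forall>\<^sub>F s in at_left t. s \<in> {max 0 (t - d)<..<t}"
      using \<open>0 < d\<close> \<open>0 < t\<close> by (intro eventually_at_left_real) auto
    then show ?thesis unfolding F
      by (rule eventually_mono) (auto simp: dist_real_def)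
  qed
  with close show "\<forall>\<^sub>F s in F. dist (total_variation g s) (total_variation g t) < \<epsilon>"
  proof eventually_elim
    case (elim s)
    have nogap: "p k \<notin> {min s t<..<max s t}" if "k \<le> n" for k
    proof
      assume "p k \<in> {min s t<..<max s t}"
      then have "p k \<noteq> t" "dist t (p k) < d"
        using elim by (auto simp: dist_real_def min_def max_def split: if_splits)
      then show False using d(2) that by force
    qed
    have "total_variation g (max s t) - total_variation g (min s t)
        < \<bar>g (max s t) - g (min s t)\<bar> + \<epsilon> / 2"
      using elim \<open>0 \<le> t\<close> p nogap
      by (intro total_variation_gap[OF g, where K = "t + 1" and p = p and n = n]) auto
    moreover have "total_variation g (min s t) \<le> total_variation g (max s t)"
    proof -
      have "min s t \<le> max s t" "0 \<le> min s t" using elim \<open>0 \<le> t\<close> by auto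
      from total_variation_increment[OF g this(2,1)] show ?thesis by linarith
    qed
    ultimately show ?case using elim
      by (cases "s \<le> t") (auto simp: dist_real_def abs_minus_commute)
  qed
qed

section \<open>Continuous paths have non-atomic variation measures\<close>

lemma continuous_on_max_zeroI:
  fixes g :: "real \<Rightarrow> 'b::topological_space"
  assumes right: "\<And>t. 0 \<le> t \<Longrightarrow> (g \<longlongrightarrow> g t) (at_right t)"
    and left: "\<And>t. 0 < t \<Longrightarrow> (g \<longlongrightarrow> g t) (at_left t)"
  shows "continuous_on UNIV (\<lambda>t. g (max 0 t))"
proof -
  \<comment> \<open>Before zero the extended path is frozen at \<open>g 0\<close>, so only the limit
    from the right is a condition at zero.\<close>
  have "((\<lambda>s. g (max 0 s)) \<longlongrightarrow> g (max 0 t)) (at t)" for t :: real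
    unfolding filterlim_at_split
  proof
    show "((\<lambda>s. g (max 0 s)) \<longlongrightarrow> g (max 0 t)) (at_left t)"
    proof (cases "0 < t")
      case True
      have "\<forall>\<^sub>F s in at_left t. g s = g (max 0 s)"
        by (rule eventually_mono[OF eventually_at_left_real[OF True]]) simp
      then show ?thesis using left[OF True] True Lim_transform_eventually by fastforce
    next
      case False
      have "\<forall>\<^sub>F s in at_left t. g (max 0 t) = g (max 0 s)"
        using False by (intro eventually_mono[OF eventually_at_left_real[of "t - 1"]]) auto
      then show ?thesis using Lim_transform_eventually tendsto_const by fastforce
    qed
    show "((\<lambda>s. g (max 0 s)) \<longlongrightarrow> g (max 0 t)) (at_right t)"
    proof (cases "0 \<le> t")
      case True
      have "\<forall>\<^sub>F s in at_right t. g s = g (max 0 s)"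
        using True by (intro eventually_mono[OF eventually_at_right_real[of t "t + 1"]]) auto
      then show ?thesis using right[OF True] True Lim_transform_eventually by fastforce
    next
      case False
      have "\<forall>\<^sub>F s in at_right t. g (max 0 t) = g (max 0 s)"
        using False by (intro eventually_mono[OF eventually_at_right_real[of t 0]]) auto
      then show ?thesis using Lim_transform_eventually tendsto_const by fastforce
    qed
  qed
  then show ?thesis by (simp add: continuous_on_def)
qed

lemma emeasure_interval_measure_singleton:
  assumes "mono F" "continuous_on UNIV F"
  shows "emeasure (interval_measure F) {x} = 0"
  using emeasure_interval_measure_Icc[of x x F] assms by (simp add: monoD)

lemma mono_jordan_parts:
  fixes g V :: "real \<Rightarrow> real"
  assumes "\<And>s t. s \<le> t \<Longrightarrow> \<bar>g t - g s\<bar> \<le> V t - V s"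
  shows "mono (\<lambda>t. (V t + (g t - c)) / 2)" "mono (\<lambda>t. (V t - (g t - c)) / 2)"
proof -
  have *: "V s + (g s - c) \<le> V t + (g t - c)" "V s - (g s - c) \<le> V t - (g t - c)"
    if "s \<le> t" for s t
    using assms[OF that] by linarith+
  show "mono (\<lambda>t. (V t + (g t - c)) / 2)"
    by (rule monoI, rule divide_right_mono) (rule *, simp_all)
  show "mono (\<lambda>t. (V t - (g t - c)) / 2)"
    by (rule monoI, rule divide_right_mono) (rule *, simp_all)
qed

text \<open>The total variation inherits both one-sided limits from \<open>g\<close>. Hence the
  distribution functions of the two Jordan parts are monotone and continuous, and such functions
  generate measures without atoms.\<close>

lemma variation_measure_singleton:
  assumes g: "finite_variation g"
    and right: "\<And>t. 0 \<le> t \<Longrightarrow> (g \<longlongrightarrow> g t) (at_right t)"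
    and left: "\<And>t. 0 < t \<Longrightarrow> (g \<longlongrightarrow> g t) (at_left t)"
  shows "emeasure (pos_variation_measure g) {x} = 0"
    and "emeasure (neg_variation_measure g) {x} = 0"
proof -
  have "continuous_on UNIV (\<lambda>t. g (max 0 t))"
    by (rule continuous_on_max_zeroI[where g = g]) (use right left in auto)
  moreover have "continuous_on UNIV (\<lambda>t. total_variation g (max 0 t))"
    by (rule continuous_on_max_zeroI[where g = "total_variation g"])
       (use right left in \<open>auto intro: total_variation_tendsto[OF g]\<close>)
  ultimately have cont: "continuous_on UNIV (\<lambda>t. g (max 0 t))"
    "continuous_on UNIV (\<lambda>t. total_variation g (max 0 t))" .
  have inc: "\<bar>g (max 0 t) - g (max 0 s)\<bar> \<le> total_variation g (max 0 t) - total_variation g (max 0 s)"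
    if "s \<le> t" for s t using that by (intro total_variation_increment[OF g]) auto
  note parts = mono_jordan_parts[of "\<lambda>t. g (max 0 t)" "\<lambda>t. total_variation g (max 0 t)"]
  have "mono (\<lambda>t. (total_variation g (max 0 t) + (g (max 0 t) - g 0)) / 2)"
    by (rule parts(1)) (rule inc)
  then show "emeasure (pos_variation_measure g) {x} = 0"
    unfolding pos_variation_measure_def
    by (rule emeasure_interval_measure_singleton) (intro continuous_intros cont; simp)
  have "mono (\<lambda>t. (total_variation g (max 0 t) - (g (max 0 t) - g 0)) / 2)"
    by (rule parts(2)) (rule inc)
  then show "emeasure (neg_variation_measure g) {x} = 0"
    unfolding neg_variation_measure_def
    by (rule emeasure_interval_measure_singleton) (intro continuous_intros cont; simp)
qed

section \<open>Jumps\<close>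

lemma left_lim_tendsto:
  assumes "has_left_limits g" "0 < t"
  shows "(g \<longlongrightarrow> left_lim g t) (at_left t)"
  using assms by (auto simp: has_left_limits_def left_lim_def tendsto_Lim)

lemma right_lim_tendsto:
  assumes "has_right_limits g" "0 \<le> t"
  shows "(g \<longlongrightarrow> right_lim g t) (at_right t)"
  using assms by (auto simp: has_right_limits_def right_lim_def tendsto_Lim)

text \<open>Induction on the largest jump time \<open>s\<close>. For \<open>u\<close> between the
  earlier times and \<open>s\<close>, the earlier jumps are bounded by the variation up to
  \<open>u\<close>, and the increment from \<open>u\<close> to \<open>s\<close> by the variation
  after \<open>u\<close>. Letting \<open>u\<close> increase to \<open>s\<close> turns this increment
  into the jump.\<close>

lemma sum_jumps_le:
  assumes g: "finite_variation g" and lim: "has_left_limits g" and "finite S"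
    and "S \<subseteq> {a<..b}" "0 \<le> a" "a \<le> b"
  shows "(\<Sum>s\<in>S. \<bar>g s - left_lim g s\<bar>) \<le> total_variation g b - total_variation g a"
  using \<open>finite S\<close> \<open>S \<subseteq> {a<..b}\<close> \<open>a \<le> b\<close>
proof (induction S arbitrary: b rule: finite_linorder_max_induct)
  case empty
  then show ?case using total_variation_increment[OF g, of a b] \<open>0 \<le> a\<close> by simp
next
  case (insert s S)
  \<comment> \<open>Inserting \<open>a\<close> covers an empty \<open>S\<close> and keeps
    \<open>u\<close> above \<open>a\<close>, so that the induction hypothesis applies on ]a,
    u].\<close>
  define c where "c = Max (insert a S)"
  have c: "a \<le> c" "c < s" "\<And>x. x \<in> S \<Longrightarrow> x \<le> c"
    unfolding c_def using insert by auto
  have "(\<Sum>x\<in>S. \<bar>g x - left_lim g x\<bar>) + \<bar>g s - g u\<bar> \<le> total_variation g b - total_variation g a"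
    if "u \<in> {c<..<s}" for u
  proof -
    have "(\<Sum>x\<in>S. \<bar>g x - left_lim g x\<bar>) \<le> total_variation g u - total_variation g a"
      using that c insert by (intro insert.IH) force+
    then show ?thesis
      using total_variation_increment[OF g, of u s] total_variation_increment[OF g, of s b] that c
        insert.prems \<open>0 \<le> a\<close> by auto
  qed
  then have ev: "\<forall>\<^sub>F u in at_left s. (\<Sum>x\<in>S. \<bar>g x - left_lim g x\<bar>) + \<bar>g s - g u\<bar>
      \<le> total_variation g b - total_variation g a"
    using eventually_at_left_real[OF c(2)] by (auto elim: eventually_mono)
  have "((\<lambda>u. (\<Sum>x\<in>S. \<bar>g x - left_lim g x\<bar>) + \<bar>g s - g u\<bar>)
      \<longlongrightarrow> (\<Sum>x\<in>S. \<bar>g x - left_lim g x\<bar>) + \<bar>g s - left_lim g s\<bar>) (at_left s)"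
    using insert.prems \<open>0 \<le> a\<close> by (intro tendsto_intros left_lim_tendsto lim) auto
  from tendsto_upperbound[OF this ev] have "(\<Sum>x\<in>S. \<bar>g x - left_lim g x\<bar>) + \<bar>g s - left_lim g s\<bar>
      \<le> total_variation g b - total_variation g a"
    by simp
  then show ?case using insert by (subst sum.insert) (auto simp: add.commute)
qed

lemma jumps_abs_summable:
  assumes g: "finite_variation g" "has_left_limits g" and "0 \<le> a"
  shows "(\<lambda>s. norm (g s - left_lim g s)) summable_on {a<..b}"
proof (cases "a \<le> b")
  case True
  then show ?thesis unfolding abs_summable_iff_bdd_above using assms
    by (intro bdd_aboveI2[where M = "total_variation g b - total_variation g a"])
       (auto intro!: sum_jumps_le)
qed simp

section \<open>Absolutely convergent sums over shrinking intervals\<close>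

lemma abs_summable_small_remainder:
  fixes j :: "'i \<Rightarrow> 'b::banach"
  assumes j: "(\<lambda>x. norm (j x)) summable_on A" and "0 < \<epsilon>"
  obtains S where "finite S" "S \<subseteq> A" "\<And>B. B \<subseteq> A - S \<Longrightarrow> norm (infsum j B) < \<epsilon>"
proof -
  \<comment> \<open>\<open>S\<close> carries all but at most \<epsilon>/2 of the sum of norms; a set
    disjoint from \<open>S\<close> can only use what remains.\<close>
  obtain S where S: "finite S" "S \<subseteq> A"
    "dist (\<Sum>x\<in>S. norm (j x)) (infsum (\<lambda>x. norm (j x)) A) \<le> \<epsilon> / 2"
    using infsum_finite_approximation[OF j, of "\<epsilon> / 2"] \<open>0 < \<epsilon>\<close> by auto
  have "norm (infsum j B) < \<epsilon>" if B: "B \<subseteq> A - S" for B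
  proof -
    have sub: "(\<lambda>x. norm (j x)) summable_on X" if "X \<subseteq> A" for X using summable_on_subset_banach[OF j that] .
    have "norm (infsum j B) \<le> infsum (\<lambda>x. norm (j x)) B"
      using B by (intro norm_infsum_bound sub) auto
    also have "\<dots> = infsum (\<lambda>x. norm (j x)) (S \<union> B) - (\<Sum>x\<in>S. norm (j x))"
      using B S by (subst infsum_Un_disjoint) (auto intro!: sub)
    also have "\<dots> \<le> infsum (\<lambda>x. norm (j x)) A - (\<Sum>x\<in>S. norm (j x))"
      using B S by (intro diff_right_mono infsum_mono2 sub) auto
    also have "\<dots> < \<epsilon>" using S(3) \<open>0 < \<epsilon>\<close> unfolding dist_real_def by linarith
    finally show ?thesis .
  qed
  then show thesis using that S by blast
qed

lemma infsum_Ioc_split: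
  fixes j :: "real \<Rightarrow> 'b::banach"
  assumes "(\<lambda>x. norm (j x)) summable_on {a<..c}" "a \<le> b" "b \<le> c"
  shows "infsum j {a<..c} = infsum j {a<..b} + infsum j {b<..c}"
proof -
  have sub: "j summable_on X" if "X \<subseteq> {a<..c}" for X
    using abs_summable_summable[OF summable_on_subset_banach[OF assms(1) that]] .
  have "infsum j ({a<..b} \<union> {b<..c}) = infsum j {a<..b} + infsum j {b<..c}"
    using assms by (intro infsum_Un_disjoint sub) auto
  moreover have "{a<..b} \<union> {b<..c} = {a<..c}" using assms by auto
  ultimately show ?thesis by simp
qed

text \<open>As ]t, s] omits \<open>t\<close>, it eventually misses the finite set outside of which
  all partial sums are small.\<close>

lemma infsum_Ioc_tendsto_right:
  fixes j :: "real \<Rightarrow> 'b::banach"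
  assumes j: "(\<lambda>x. norm (j x)) summable_on {t<..c}" "t < c"
  shows "((\<lambda>s. infsum j {t<..s}) \<longlongrightarrow> 0) (at_right t)"
proof (rule tendstoI)
  fix \<epsilon> :: real assume "0 < \<epsilon>"
  then obtain S where S: "finite S" "S \<subseteq> {t<..c}"
    "\<And>B. B \<subseteq> {t<..c} - S \<Longrightarrow> norm (infsum j B) < \<epsilon>"
    using abs_summable_small_remainder[OF j(1)] by metis
  define m where "m = Min (insert c S)"
  have m: "t < m" "m \<le> c" "\<And>x. x \<in> S \<Longrightarrow> m \<le> x" unfolding m_def using S j(2) by auto
  have "x \<notin> S" if "x \<in> {t<..s}" "s \<in> {t<..<m}" for x s using m(3)[of x] that by auto
  then have "{t<..s} \<subseteq> {t<..c} - S" if "s \<in> {t<..<m}" for s using that m(2) by fastforce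
  then have "dist (infsum j {t<..s}) 0 < \<epsilon>" if "s \<in> {t<..<m}" for s using that S(3) by simp
  then show "\<forall>\<^sub>F s in at_right t. dist (infsum j {t<..s}) 0 < \<epsilon>"
    using eventually_at_right_real[OF m(1)] by (auto elim: eventually_mono)
qed

text \<open>Each interval ]s, t] contains \<open>t\<close>, whose term survives in the limit. The
  other exceptional points are finitely many and eventually lie to the left of
  \<open>s\<close>.\<close>

lemma infsum_Ioc_tendsto_left:
  fixes j :: "real \<Rightarrow> 'b::banach"
  assumes j: "(\<lambda>x. norm (j x)) summable_on {c<..t}" "c < t"
  shows "((\<lambda>s. infsum j {s<..t}) \<longlongrightarrow> j t) (at_left t)"
proof (rule tendstoI)
  fix \<epsilon> :: real assume "0 < \<epsilon>"
  then obtain S where S: "finite S" "S \<subseteq> {c<..t}"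
    "\<And>B. B \<subseteq> {c<..t} - S \<Longrightarrow> norm (infsum j B) < \<epsilon>"
    using abs_summable_small_remainder[OF j(1)] by metis
  define m where "m = Max (insert c (S - {t}))"
  have m: "m < t" "c \<le> m" "\<And>x. x \<in> S - {t} \<Longrightarrow> x \<le> m"
    unfolding m_def using S(1,2) j(2) by (subst Max_less_iff; force) (auto intro!: Max_ge S(1))
  have "dist (infsum j {s<..t}) (j t) < \<epsilon>" if s: "s \<in> {m<..<t}" for s
  proof -
    have "x \<notin> S" if "x \<in> {s<..<t}" for x using m(3)[of x] s that by auto
    then have sub: "{s<..<t} \<subseteq> {c<..t} - S" using s m(2) by auto
    have "j summable_on {s<..<t}"
      using sub by (intro abs_summable_summable[OF summable_on_subset_banach[OF j(1)]]) auto
    then have "infsum j ({s<..<t} \<union> {t}) = infsum j {s<..<t} + j t"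
      by (subst infsum_Un_disjoint) auto
    moreover have "{s<..<t} \<union> {t} = {s<..t}" using s by auto
    ultimately show ?thesis using S(3)[OF sub] by (simp add: dist_norm)
  qed
  then show "\<forall>\<^sub>F s in at_left t. dist (infsum j {s<..t}) (j t) < \<epsilon>"
    using eventually_at_left_real[OF m(1)] by (auto elim: eventually_mono)
qed

section \<open>Finite variation and continuity of the continuous part\<close>

lemma continuous_part_increment:
  assumes g: "finite_variation g" "has_left_limits g" and "0 \<le> a" "a \<le> b"
  shows "continuous_part g b - continuous_part g a
    = g b - g a - (\<Sum>\<^sub>\<infinity>s\<in>{a<..b}. g s - left_lim g s)"
  unfolding continuous_part_def
  using infsum_Ioc_split[OF jumps_abs_summable[OF g order.refl] \<open>0 \<le> a\<close> \<open>a \<le> b\<close>] by simp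

text \<open>The increment of \<open>g\<close> and the sum of its jumps are each bounded by the
  increment of the total variation, which explains the dominating function
  \<open>2 * ?V\<close>.\<close>

lemma finite_variation_continuous_part:
  assumes g: "finite_variation g" "has_left_limits g"
  shows "finite_variation (continuous_part g)"
proof (rule finite_variationI)
  fix a b :: real assume "0 \<le> a" "a \<le> b"
  let ?V = "total_variation g"
  have "\<bar>\<Sum>\<^sub>\<infinity>s\<in>{a<..b}. g s - left_lim g s\<bar> \<le> (\<Sum>\<^sub>\<infinity>s\<in>{a<..b}. \<bar>g s - left_lim g s\<bar>)"
    using norm_infsum_bound[OF jumps_abs_summable[OF g \<open>0 \<le> a\<close>]] by simp
  also have "\<dots> \<le> ?V b - ?V a"
    using sum_jumps_le[OF g _ _ \<open>0 \<le> a\<close> \<open>a \<le> b\<close>] jumps_abs_summable[OF g \<open>0 \<le> a\<close>]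
    by (intro infsum_le_finite_sums) auto
  finally show "\<bar>continuous_part g b - continuous_part g a\<bar> \<le> 2 * ?V b - 2 * ?V a"
    using total_variation_increment[OF g(1) \<open>0 \<le> a\<close> \<open>a \<le> b\<close>]
      continuous_part_increment[OF g \<open>0 \<le> a\<close> \<open>a \<le> b\<close>] by linarith
qed

lemma continuous_part_tendsto_right:
  assumes "finite_variation g" "cadlag g" "0 \<le> t"
  shows "(continuous_part g \<longlongrightarrow> continuous_part g t) (at_right t)"
proof -
  have g: "finite_variation g" "has_left_limits g" "(g \<longlongrightarrow> g t) (at_right t)"
    using assms by (auto simp: cadlag_def right_cont_def)
  have jumps: "((\<lambda>s. \<Sum>\<^sub>\<infinity>u\<in>{t<..s}. g u - left_lim g u) \<longlongrightarrow> 0) (at_right t)"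
    using jumps_abs_summable[OF g(1,2) \<open>0 \<le> t\<close>, of "t + 1"] by (rule infsum_Ioc_tendsto_right) simp
  have "((\<lambda>s. continuous_part g t + (g s - g t) - (\<Sum>\<^sub>\<infinity>u\<in>{t<..s}. g u - left_lim g u))
      \<longlongrightarrow> continuous_part g t + (g t - g t) - 0) (at_right t)"
    by (intro tendsto_intros g jumps)
  moreover have "continuous_part g t + (g s - g t) - (\<Sum>\<^sub>\<infinity>u\<in>{t<..s}. g u - left_lim g u)
      = continuous_part g s" if "s \<in> {t<..<t + 1}" for s
    using continuous_part_increment[OF g(1,2) \<open>0 \<le> t\<close>, of s] that by simp
  then have "\<forall>\<^sub>F s in at_right t. continuous_part g t + (g s - g t)
      - (\<Sum>\<^sub>\<infinity>u\<in>{t<..s}. g u - left_lim g u) = continuous_part g s"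
    using eventually_mono[OF eventually_at_right_real[of t "t + 1"]] by auto
  ultimately show ?thesis using Lim_transform_eventually by fastforce
qed

text \<open>As \<open>s\<close> increases to \<open>t\<close>, the increment of \<open>g\<close>
  over ]s, t] and the jump sum over ]s, t] both tend to the jump of \<open>g\<close> at
  \<open>t\<close>, and they cancel.\<close>

lemma continuous_part_tendsto_left:
  assumes g: "finite_variation g" "has_left_limits g" and "0 < t"
  shows "(continuous_part g \<longlongrightarrow> continuous_part g t) (at_left t)"
proof -
  have jumps: "((\<lambda>s. \<Sum>\<^sub>\<infinity>u\<in>{s<..t}. g u - left_lim g u) \<longlongrightarrow> g t - left_lim g t) (at_left t)"
    using jumps_abs_summable[OF g order.refl] \<open>0 < t\<close> by (rule infsum_Ioc_tendsto_left)
  have "((\<lambda>s. continuous_part g t - (g t - g s) + (\<Sum>\<^sub>\<infinity>u\<in>{s<..t}. g u - left_lim g u))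
      \<longlongrightarrow> continuous_part g t - (g t - left_lim g t) + (g t - left_lim g t)) (at_left t)"
    by (intro tendsto_intros left_lim_tendsto[OF g(2) \<open>0 < t\<close>] jumps)
  moreover have "continuous_part g t - (g t - g s) + (\<Sum>\<^sub>\<infinity>u\<in>{s<..t}. g u - left_lim g u)
      = continuous_part g s" if "s \<in> {0<..<t}" for s
    using continuous_part_increment[OF g, of s t] that by simp
  then have "\<forall>\<^sub>F s in at_left t. continuous_part g t - (g t - g s)
      + (\<Sum>\<^sub>\<infinity>u\<in>{s<..t}. g u - left_lim g u) = continuous_part g s"
    by (rule eventually_mono[OF eventually_at_left_real[OF \<open>0 < t\<close>], rotated])
  ultimately show ?thesis using Lim_transform_eventually by fastforce
qed

lemma variation_measure_continuous_part_singleton: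
  assumes "finite_variation g" "cadlag g"
  shows "emeasure (pos_variation_measure (continuous_part g)) {x} = 0"
    and "emeasure (neg_variation_measure (continuous_part g)) {x} = 0"
proof -
  have "has_left_limits g" using assms by (simp add: cadlag_def)
  then show "emeasure (pos_variation_measure (continuous_part g)) {x} = 0"
    "emeasure (neg_variation_measure (continuous_part g)) {x} = 0"
    using variation_measure_singleton[OF finite_variation_continuous_part[OF assms(1)], of x]
      continuous_part_tendsto_right[OF assms] continuous_part_tendsto_left[OF assms(1)]
    by blast+
qed

section \<open>Right limits\<close>

text \<open>Regularity of the space puts a closed set \<open>- W\<close> between a neighbourhood
  \<open>V\<close> of \<open>a\<close> and \<open>U\<close>. Where the values of \<open>g\<close>
  stay in \<open>V\<close>, their right limits stay in \<open>- W\<close>.\<close>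

lemma tendsto_right_lim:
  fixes g :: "real \<Rightarrow> 'b::t3_space"
  assumes g: "has_right_limits g" and F: "F = at_right t \<and> 0 \<le> t \<or> F = at_left t \<and> 0 < t"
    and lim: "(g \<longlongrightarrow> a) F"
  shows "(right_lim g \<longlongrightarrow> a) F"
proof (rule topological_tendstoI)
  fix U assume "open U" "a \<in> U"
  then obtain V W where VW: "open V" "a \<in> V" "open W" "- U \<subseteq> W" "V \<inter> W = {}"
    using t3_space[of "- U" a] by (auto simp: closed_def)
  have ev: "\<forall>\<^sub>F s in F. g s \<in> V" using topological_tendstoD[OF lim VW(1,2)] .
  \<comment> \<open>Right limits are only given from time zero on, hence the bound
    \<open>0 \<le> b\<close> and the maximum with zero on the left side.\<close>
  obtain b c where bc: "0 \<le> b" "\<forall>\<^sub>F s in F. s \<in> {b<..<c}" "\<And>s. s \<in> {b<..<c} \<Longrightarrow> g s \<in> V"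
  proof (cases "F = at_right t")
    case True
    then obtain c where c: "t < c" "\<And>s. t < s \<Longrightarrow> s < c \<Longrightarrow> g s \<in> V"
      using ev by (auto simp: eventually_at_right_field)
    then show ?thesis
      using that[of t c] F True eventually_at_right_real[OF c(1)] by auto
  next
    case False
    then obtain b where b: "b < t" "\<And>s. b < s \<Longrightarrow> s < t \<Longrightarrow> g s \<in> V"
      using ev F by (auto simp: eventually_at_left_field)
    then show ?thesis
      using that[of "max 0 b" t] F False eventually_at_left_real[of "max 0 b" t] by auto
  qed
  have "right_lim g s \<in> U" if s: "s \<in> {b<..<c}" for s
  proof -
    have "g u \<in> - W" if "u \<in> {s<..<c}" for u
      using bc(3)[of u] VW(5) s that by auto
    then have "\<forall>\<^sub>F u in at_right s. g u \<in> - W"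
      using s eventually_mono[OF eventually_at_right_real[of s c]] by auto
    then have "right_lim g s \<in> - W"
      using s bc(1) VW(3) right_lim_tendsto[OF g, of s]
      by (intro Lim_in_closed_set[of "- W" g "at_right s"]) (auto simp: closed_def)
    then show ?thesis using VW(4) by auto
  qed
  with bc(2) show "\<forall>\<^sub>F s in F. right_lim g s \<in> U" by (auto elim: eventually_mono)
qed

lemma right_lim_eq_const:
  assumes "\<And>s. t < s \<Longrightarrow> g s = a"
  shows "right_lim g t = a"
proof -
  have "\<forall>\<^sub>F s in at_right t. a = g s"
    using assms by (intro eventually_mono[OF eventually_at_right_real[of t "t + 1"]]) auto
  then have "(g \<longlongrightarrow> a) (at_right t)"
    by (rule Lim_transform_eventually[OF tendsto_const])
  then show ?thesis by (simp add: right_lim_def tendsto_Lim)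
qed

text \<open>Both claims rest on \<open>tendsto_right_lim\<close>: passing to right limits keeps left
  limits and creates right-continuity. The value \<open>y r\<close> is left free, since the left
  limit at \<open>r\<close> only sees earlier times and the path is constant from \<open>r\<close>
  on. This makes room for the additional term at \<tau>.\<close>

lemma
  fixes v y :: "real \<Rightarrow> 'b::t3_space"
  assumes v: "laglad v" and before: "\<And>t. 0 \<le> t \<Longrightarrow> t < r \<Longrightarrow> y t = right_lim v t"
    and after: "\<And>t. r \<le> t \<Longrightarrow> y t = y r" and "0 \<le> r"
  shows cadlag_right_lim_stopped: "cadlag y"
    and left_lim_right_lim_stopped: "\<And>t. 0 < t \<Longrightarrow> t \<le> r \<Longrightarrow> left_lim y t = left_lim v t"
proof -
  have rl: "has_right_limits v" and ll: "has_left_limits v" using v by (auto simp: laglad_def)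
  have left: "(y \<longlongrightarrow> left_lim v t) (at_left t)" if "0 < t" "t \<le> r" for t
  proof -
    have "\<forall>\<^sub>F s in at_left t. right_lim v s = y s"
      using that before by (intro eventually_mono[OF eventually_at_left_real[of 0 t]]) auto
    moreover have "(right_lim v \<longlongrightarrow> left_lim v t) (at_left t)"
      using that by (intro tendsto_right_lim[OF rl] left_lim_tendsto[OF ll]) auto
    ultimately show ?thesis by (rule Lim_transform_eventually[rotated])
  qed
  then show "left_lim y t = left_lim v t" if "0 < t" "t \<le> r" for t
    using that by (simp add: left_lim_def[of y] tendsto_Lim)
  have "(y \<longlongrightarrow> y t) (at_right t)" if "0 \<le> t" for t
  proof (cases "t < r")
    case True
    have "\<forall>\<^sub>F s in at_right t. right_lim v s = y s"
      using True that before by (intro eventually_mono[OF eventually_at_right_real[of t r]]) auto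
    moreover have "(right_lim v \<longlongrightarrow> right_lim v t) (at_right t)"
      using that by (intro tendsto_right_lim[OF rl] right_lim_tendsto[OF rl]) auto
    ultimately have "(y \<longlongrightarrow> right_lim v t) (at_right t)"
      by (rule Lim_transform_eventually[rotated])
    then show ?thesis using before[OF that True] by simp
  next
    case False
    then have "y t = y s" if "t < s" for s using after[of t] after[of s] that by simp
    then have "\<forall>\<^sub>F s in at_right t. y t = y s"
      by (intro eventually_mono[OF eventually_at_right_real[of t "t + 1"]]) auto
    then show ?thesis by (rule Lim_transform_eventually[OF tendsto_const])
  qed
  moreover have "\<exists>a. (y \<longlongrightarrow> a) (at_left t)" if "0 < t" for t
  proof (cases "t \<le> r")
    case True
    then show ?thesis using left that by blast
  next
    case False
    have "y r = y s" if "s \<in> {r<..<t}" for s using after[of s] that by simp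
    then have "\<forall>\<^sub>F s in at_left t. y r = y s"
      using False by (intro eventually_mono[OF eventually_at_left_real[of r t]]) auto
    then have "(y \<longlongrightarrow> y r) (at_left t)"
      by (rule Lim_transform_eventually[OF tendsto_const])
    then show ?thesis ..
  qed
  ultimately show "cadlag y" by (auto simp: cadlag_def right_cont_def has_left_limits_def)
qed

section \<open>Stieltjes integrals against non-atomic measures\<close>

definition nonatomic :: "(real \<Rightarrow> real) \<Rightarrow> bool" where
  "nonatomic g \<longleftrightarrow> (\<forall>x. emeasure (pos_variation_measure g) {x} = 0 \<and>
     emeasure (neg_variation_measure g) {x} = 0)"

lemma sets_variation_measure [simp]:
  "sets (pos_variation_measure g) = sets borel" "sets (neg_variation_measure g) = sets borel"
  by (simp_all add: pos_variation_measure_def neg_variation_measure_def)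

text \<open>Meant for the driver integrals of the two equations, whose integrands agree off finitely
  many times; countable sets are null for both Jordan parts.\<close>

lemma
  assumes g: "nonatomic g" and X: "countable X" and eq: "\<And>s. s \<in> {a<..b} - X \<Longrightarrow> H s = K s"
  shows stieltjes_integrable_discrete_difference:
      "stieltjes_integrable g H a b \<longleftrightarrow> stieltjes_integrable g K a b"
    and stieltjes_integral_discrete_difference:
      "stieltjes_integral g H a b = stieltjes_integral g K a b"
proof -
  have eq': "indicator {a<..b} s *\<^sub>R H s = indicator {a<..b} s *\<^sub>R K s" if "s \<notin> X" for s
    using eq that by (auto split: split_indicator)
  show "stieltjes_integrable g H a b \<longleftrightarrow> stieltjes_integrable g K a b"
    unfolding stieltjes_integrable_def set_integrable_def using g eq'
    by (intro arg_cong2[where f = "(\<and>)"] integrable_discrete_difference[OF X])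
       (auto simp: nonatomic_def)
  show "stieltjes_integral g H a b = stieltjes_integral g K a b"
    unfolding stieltjes_integral_def set_lebesgue_integral_def using g eq'
    by (intro arg_cong2[where f = "(-)"] integral_discrete_difference[OF X])
       (auto simp: nonatomic_def)
qed

lemma set_integral_tendsto_lower:
  fixes H :: "real \<Rightarrow> 'b::{banach, second_countable_topology}"
  assumes M: "sets M = sets borel" "\<And>x. emeasure M {x} = 0"
    and H: "set_integrable M {a<..b} H" and "a < b"
  shows "((\<lambda>s. LINT u:{s<..b}|M. H u) \<longlongrightarrow> (LINT u:{a<..b}|M. H u)) (at_right a)"
proof -
  \<comment> \<open>The limit theorem applied next is about closed intervals [s, b]; without atoms
    the point \<open>s\<close> does not count.\<close>
  have "(LINT u:{s..b}|M. H u) = (LINT u:{s<..b}|M. H u)" for s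
    using M by (intro set_integral_discrete_difference[where X = "{s}"]) auto
  then show ?thesis
    using tendsto_set_lebesgue_integral_at_right[OF \<open>a < b\<close> _ H] M(1) by simp
qed

lemma stieltjes_integral_tendsto_lower:
  assumes "nonatomic g" "stieltjes_integrable g H a b" "a < b"
  shows "((\<lambda>s. stieltjes_integral g H s b) \<longlongrightarrow> stieltjes_integral g H a b) (at_right a)"
  unfolding stieltjes_integral_def
  using assms by (intro tendsto_diff set_integral_tendsto_lower)
    (auto simp: nonatomic_def stieltjes_integrable_def)

lemma stieltjes_integrable_subset:
  assumes "stieltjes_integrable g H a b" "a \<le> c"
  shows "stieltjes_integrable g H c b"
  using assms unfolding stieltjes_integrable_def by (auto elim!: set_integrable_subset)

lemma nonatomic_continuous_part:
  assumes "finite_variation g" "cadlag g"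
  shows "nonatomic (continuous_part g)"
  using variation_measure_continuous_part_singleton[OF assms] by (simp add: nonatomic_def)

section \<open>The equation along a path\<close>

lemma infsum_finite_support:
  assumes "finite S" "\<And>s. s \<in> A - S \<Longrightarrow> f s = 0"
  shows "infsum f A = sum f (A \<inter> S)"
  using infsum_cong_neutral[of "A \<inter> S" A f f] assms by auto

text \<open>Here \<open>\<eta>\<close> stands for the terms of \<open>h\<close> along a fixed path,
  \<open>H\<close> for the driver and \<open>C\<close> for the terminal contribution. The sum over
  [t, r[ counts time \<open>t\<close> while the limit of the sums over [s, r[ does not, and this
  single term is the right jump of \<open>v\<close>.\<close>

lemma
  fixes v N l \<eta> :: "real \<Rightarrow> real"
  assumes g: "nonatomic g" "stieltjes_integrable g H 0 r"
    and N: "right_cont N" and l: "right_cont l"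
    and S: "finite S" "\<forall>s\<ge>0. s \<notin> S \<longrightarrow> \<eta> s = 0"
    and eq: "\<forall>t\<in>{0..r}. v t = C - stieltjes_integral g H t r - (\<Sum>\<^sub>\<infinity>s\<in>{t..<r}. \<eta> s)
      - (N r - N t) + l r - l t"
    and t: "0 \<le> t" "t < r"
  shows right_lim_equation: "right_lim v t = C - stieltjes_integral g H t r
      - (\<Sum>\<^sub>\<infinity>s\<in>{t<..<r}. \<eta> s) - (N r - N t) + l r - l t"
    and right_jump_equation: "right_lim v t = v t + \<eta> t"
proof -
  \<comment> \<open>The next support point after \<open>t\<close>, capped at \<open>r\<close>: for
    \<open>s\<close> strictly between \<open>t\<close> and \<open>m\<close>, the sum over [s, r[
    does not depend on \<open>s\<close>.\<close>
  define m where "m = Min (insert r (S \<inter> {t<..}))"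
  have m: "t < m" "m \<le> r" "\<And>s. s \<in> S \<Longrightarrow> t < s \<Longrightarrow> m \<le> s"
    unfolding m_def using S(1) t by auto
  have sum: "(\<Sum>\<^sub>\<infinity>u\<in>A. \<eta> u) = sum \<eta> (A \<inter> S)" if "A \<subseteq> {0..}" for A
    using that S by (intro infsum_finite_support) auto
  have "(\<Sum>\<^sub>\<infinity>u\<in>{s..<r}. \<eta> u) = (\<Sum>\<^sub>\<infinity>u\<in>{t<..<r}. \<eta> u)" if "s \<in> {t<..<m}" for s
  proof -
    have "{s..<r} \<inter> S = {t<..<r} \<inter> S" using that m by fastforce
    then show ?thesis using that t by (subst (1 2) sum) auto
  qed
  then have "\<forall>\<^sub>F s in at_right t. C - stieltjes_integral g H s r - (\<Sum>\<^sub>\<infinity>u\<in>{t<..<r}. \<eta> u)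
      - (N r - N s) + l r - l s = v s"
    using m t eq by (intro eventually_mono[OF eventually_at_right_real[OF m(1)]]) auto
  moreover have "((\<lambda>s. C - stieltjes_integral g H s r - (\<Sum>\<^sub>\<infinity>u\<in>{t<..<r}. \<eta> u)
      - (N r - N s) + l r - l s) \<longlongrightarrow> C - stieltjes_integral g H t r
      - (\<Sum>\<^sub>\<infinity>s\<in>{t<..<r}. \<eta> s) - (N r - N t) + l r - l t) (at_right t)"
    using t N l stieltjes_integrable_subset[OF g(2) t(1)]
    by (intro tendsto_intros stieltjes_integral_tendsto_lower g(1)) (auto simp: right_cont_def)
  ultimately have "(v \<longlongrightarrow> C - stieltjes_integral g H t r
      - (\<Sum>\<^sub>\<infinity>s\<in>{t<..<r}. \<eta> s) - (N r - N t) + l r - l t) (at_right t)"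
    using Lim_transform_eventually by fast
  then show *: "right_lim v t = C - stieltjes_integral g H t r
      - (\<Sum>\<^sub>\<infinity>s\<in>{t<..<r}. \<eta> s) - (N r - N t) + l r - l t"
    by (simp add: right_lim_def tendsto_Lim)
  have "(\<Sum>\<^sub>\<infinity>s\<in>{t..<r}. \<eta> s) = \<eta> t + (\<Sum>\<^sub>\<infinity>s\<in>{t<..<r}. \<eta> s)"
  \<comment> \<open>Adding \<open>t\<close> to the support set lets its term be split off whether or
    not \<open>t\<close> lies in \<open>S\<close>.\<close>
  proof -
    have "(\<Sum>\<^sub>\<infinity>s\<in>{t..<r}. \<eta> s) = sum \<eta> ({t..<r} \<inter> insert t S)"
      using t S by (intro infsum_finite_support) auto
    moreover have "{t..<r} \<inter> insert t S = insert t ({t<..<r} \<inter> S)" using t by auto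
    moreover have "{t<..<r} \<subseteq> {0..}" using t by auto
    ultimately show ?thesis using S(1) by (simp add: sum)
  qed
  then show "right_lim v t = v t + \<eta> t" using * bspec[OF eq, of t] t by simp
qed

section \<open>Measurability\<close>

text \<open>The preimages under such a process are among the generators of the optional
  sigma-algebra.\<close>

lemma adapted_cadlag_optional:
  fixes X :: "real \<Rightarrow> 'a \<Rightarrow> real"
  assumes "adapted F X" "\<And>\<omega>. \<omega> \<in> space \<mu> \<Longrightarrow> cadlag (\<lambda>t. X t \<omega>)"
  shows "optional \<mu> F X"
  unfolding optional_def
proof (rule measurableI)
  let ?G = "{{(t, \<omega>). t \<ge> 0 \<and> \<omega> \<in> space \<mu> \<and> X t \<omega> \<in> B} | (X :: real \<Rightarrow> 'a \<Rightarrow> real) B.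
        adapted F X \<and> (\<forall>\<omega>\<in>space \<mu>. cadlag (\<lambda>t. X t \<omega>)) \<and> B \<in> sets borel}"
  have G: "?G \<subseteq> Pow ({0..} \<times> space \<mu>)" by auto
  fix B :: "real set" assume "B \<in> sets borel"
  have "(\<lambda>(t, \<omega>). X t \<omega>) -` B \<inter> space (optional_sigma \<mu> F)
      = {(t, \<omega>). t \<ge> 0 \<and> \<omega> \<in> space \<mu> \<and> X t \<omega> \<in> B}"
    unfolding optional_sigma_def space_measure_of[OF G] by auto
  also have "\<dots> \<in> sets (optional_sigma \<mu> F)"
    unfolding optional_sigma_def using assms \<open>B \<in> sets borel\<close> by (intro in_measure_of[OF G]) blast
  finally show "(\<lambda>(t, \<omega>). X t \<omega>) -` B \<inter> space (optional_sigma \<mu> F) \<in> sets (optional_sigma \<mu> F)" .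
qed simp

text \<open>By completeness each subset of a null set lies in \<open>F 0\<close>, hence in
  \<open>F t\<close>, so a preimage can be corrected on the exceptional set. This passes
  measurability to a variable built from \<open>h\<close>.\<close>

lemma borel_measurable_AE_eq:
  fixes X Y :: "'a \<Rightarrow> 'b::topological_space"
  assumes F: "filtration (space \<mu>) F" "usual_conditions \<mu> F"
    and X: "X \<in> borel_measurable (F t)" and ae: "AE \<omega> in \<mu>. X \<omega> = Y \<omega>"
  shows "Y \<in> borel_measurable (F t)"
proof (rule measurableI)
  have space: "space (F t) = space \<mu>" by (rule filtration.space_F[OF F(1)])
  from ae obtain A where A: "A \<in> null_sets \<mu>" "{\<omega> \<in> space \<mu>. X \<omega> \<noteq> Y \<omega>} \<subseteq> A"
    unfolding eventually_ae_filter by blast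
  have null: "B \<in> sets (F t)" if "B \<subseteq> A" for B
    using F(2) A(1) that filtration.sets_F_mono[OF F(1), of 0 t] by (auto simp: usual_conditions_def)
  fix B :: "'b set" assume "B \<in> sets borel"
  then have "X -` B \<inter> space (F t) - A \<in> sets (F t)" using X null by auto
  moreover have "Y -` B \<inter> space (F t) \<inter> A \<in> sets (F t)" by (rule null) auto
  ultimately have "(X -` B \<inter> space (F t) - A) \<union> (Y -` B \<inter> space (F t) \<inter> A) \<in> sets (F t)"
    by (rule sets.Un)
  also have "(X -` B \<inter> space (F t) - A) \<union> (Y -` B \<inter> space (F t) \<inter> A) = Y -` B \<inter> space (F t)"
    using A(2) space by auto
  finally show "Y -` B \<inter> space (F t) \<in> sets (F t)" .
qed simp

text \<open>For every \<open>s\<close> beyond \<open>t\<close>, the right limit is a limit of values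
  of \<open>v\<close> at times between \<open>t\<close> and \<open>s\<close>, hence
  \<open>F s\<close>-measurable. Right-continuity of the filtration then gives
  \<open>F t\<close>.\<close>

lemma borel_measurable_right_lim:
  fixes v :: "real \<Rightarrow> 'a \<Rightarrow> 'b::metric_space"
  assumes F: "filtration (space \<mu>) F" "usual_conditions \<mu> F"
    and v: "adapted F v" "\<And>\<omega>. \<omega> \<in> space \<mu> \<Longrightarrow> has_right_limits (\<lambda>t. v t \<omega>)" and "0 \<le> t"
  shows "(\<lambda>\<omega>. right_lim (\<lambda>s. v s \<omega>) t) \<in> borel_measurable (F (ennreal t))"
proof (rule measurableI)
  have space: "space (F s) = space \<mu>" for s by (rule filtration.space_F[OF F(1)])
  fix B :: "'b set" assume B: "B \<in> sets borel"
  have "(\<lambda>\<omega>. right_lim (\<lambda>s. v s \<omega>) t) -` B \<inter> space \<mu> \<in> sets (F s)" if ts: "ennreal t < s" for s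
  proof -
    \<comment> \<open>The index \<open>s\<close> may be infinite, so a real time \<open>c\<close>
      below it is needed as the starting point of the sequence \<open>u\<close>, which decreases to
      \<open>t\<close> without reaching it.\<close>
    obtain c where c: "t < c" "ennreal c < s"
    proof -
      obtain x where "ennreal t < x" "x < s" using dense[OF ts] by blast
      then show thesis using that[of "enn2real x"] \<open>0 \<le> t\<close>
        by (cases x) (auto simp: ennreal_less_iff)
    qed
    define u where "u n = t + (c - t) / real (Suc n)" for n
    have u: "t < u n" "u n \<le> c" for n using c(1) mult_left_mono[of t c "real n"] by (auto simp: u_def field_simps)
    have "u \<longlonglongrightarrow> t + (c - t) * 0"
      unfolding u_def divide_inverse by (intro tendsto_intros LIMSEQ_inverse_real_of_nat)
    moreover have "u n \<noteq> t" for n using u(1)[of n] by simp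
    ultimately have u_lim: "filterlim u (at_right t) sequentially"
      using u(1) by (simp add: filterlim_at)
    have "v (u n) \<in> borel_measurable (F s)" for n
    proof -
      have "ennreal (u n) \<le> s" using u(2)[of n] c(2) by (meson ennreal_leI order.trans less_imp_le)
      then have "sets (F (ennreal (u n))) \<subseteq> sets (F s)" by (rule filtration.sets_F_mono[OF F(1)])
      moreover have "v (u n) \<in> borel_measurable (F (ennreal (u n)))"
        using v(1) u(1)[of n] \<open>0 \<le> t\<close> by (auto simp: adapted_def)
      ultimately show ?thesis
        using measurable_mono[of borel borel "F (ennreal (u n))" "F s"] space by auto
    qed
    moreover have "(\<lambda>n. v (u n) \<omega>) \<longlonglongrightarrow> right_lim (\<lambda>s. v s \<omega>) t" if "\<omega> \<in> space (F s)" for \<omega>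
      using filterlim_compose[OF right_lim_tendsto[OF v(2) \<open>0 \<le> t\<close>] u_lim] that space by auto
    ultimately have "(\<lambda>\<omega>. right_lim (\<lambda>s. v s \<omega>) t) \<in> borel_measurable (F s)"
      by (rule borel_measurable_LIMSEQ_metric[where f = "\<lambda>n. v (u n)"])
    from measurable_sets[OF this B] show ?thesis by (simp add: space)
  qed
  moreover have "sets (F (ennreal t)) = (\<Inter>s\<in>{ennreal t<..}. sets (F s))"
    using F(2) by (auto simp: usual_conditions_def)
  ultimately show "(\<lambda>\<omega>. right_lim (\<lambda>s. v s \<omega>) t) -` B \<inter> space (F (ennreal t)) \<in> sets (F (ennreal t))"
    by (simp add: space)
qed simp

text \<open>The event \<open>t < T \<omega>\<close> lies in \<open>F t\<close>, and a preimage under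
  \<open>Z\<close> intersected with its complement lies in \<open>F t\<close> by the definition of
  \<open>pre_sigma\<close>.\<close>

lemma (in filtration) borel_measurable_if_stopping_time:
  fixes X Z :: "'a \<Rightarrow> 'c::topological_space"
  assumes T: "stopping_time F T" and X: "X \<in> borel_measurable (F t)"
    and Z: "Z \<in> borel_measurable (pre_sigma T)"
  shows "(\<lambda>\<omega>. if t < T \<omega> then X \<omega> else Z \<omega>) \<in> borel_measurable (F t)"
proof (rule measurableI)
  fix B :: "'c set" assume "B \<in> sets borel"
  have "{\<omega> \<in> space (F t). t < T \<omega>} \<in> sets (F t)"
    using stopping_timeD2[OF T] by (simp add: pred_def)
  then have "{\<omega> \<in> space (F t). t < T \<omega>} \<inter> (X -` B \<inter> space (F t)) \<in> sets (F t)"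
    using measurable_sets[OF X \<open>B \<in> sets borel\<close>] by auto
  moreover have "{\<omega> \<in> Z -` B \<inter> \<Omega>. T \<omega> \<le> t} \<in> sets (F t)"
    using sets_pre_sigmaD[OF T measurable_sets[OF Z \<open>B \<in> sets borel\<close>], of t]
    by (simp only: space_pre_sigma)
  ultimately have "({\<omega> \<in> space (F t). t < T \<omega>} \<inter> (X -` B \<inter> space (F t)))
      \<union> {\<omega> \<in> Z -` B \<inter> \<Omega>. T \<omega> \<le> t} \<in> sets (F t)"
    by (rule sets.Un)
  also have "({\<omega> \<in> space (F t). t < T \<omega>} \<inter> (X -` B \<inter> space (F t))) \<union> {\<omega> \<in> Z -` B \<inter> \<Omega>. T \<omega> \<le> t}
      = (\<lambda>\<omega>. if t < T \<omega> then X \<omega> else Z \<omega>) -` B \<inter> space (F t)"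
    by (auto simp: space_F split: if_splits)
  finally show "(\<lambda>\<omega>. if t < T \<omega> then X \<omega> else Z \<omega>) -` B \<inter> space (F t) \<in> sets (F t)" .
qed simp

theorem proposition14p1:
  fixes \<mu> :: "'a measure" and F :: "ennreal \<Rightarrow> 'a measure"
    and \<tau> :: "'a \<Rightarrow> real" and \<xi> :: "real \<Rightarrow> 'a \<Rightarrow> real"
    and M :: "real \<Rightarrow> 'a \<Rightarrow> real ^ 'd" and D :: "real \<Rightarrow> 'a \<Rightarrow> real"
    and f :: "real \<Rightarrow> 'a \<Rightarrow> real \<Rightarrow> real \<Rightarrow> real ^ 'd \<Rightarrow> real"
    and h :: "real \<Rightarrow> 'a \<Rightarrow> real \<Rightarrow> real \<Rightarrow> real"
    and T :: "nat \<Rightarrow> 'a \<Rightarrow> ennreal" and p :: nat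
    and v y l :: "real \<Rightarrow> 'a \<Rightarrow> real" and z :: "real \<Rightarrow> 'a \<Rightarrow> real ^ 'd"
  assumes "prob_space \<mu>"
    and "filtration (space \<mu>) F" and "\<And>t. subalgebra \<mu> (F t)" and "usual_conditions \<mu> F"
    and "vector_local_martingale \<mu> F M"
    and "adapted F D"
    and "\<And>\<omega>. \<omega> \<in> space \<mu> \<Longrightarrow> cadlag (\<lambda>t. D t \<omega>) \<and> finite_variation (\<lambda>t. D t \<omega>)"
    and "\<And>i. i \<in> {1..p} \<Longrightarrow> predictable_time \<mu> F (T i)"
    and "\<And>s \<omega> a b. s \<ge> 0 \<Longrightarrow> \<omega> \<in> space \<mu> \<Longrightarrow> (\<forall>i\<in>{1..p}. T i \<omega> \<noteq> ennreal s) \<Longrightarrow> h s \<omega> a b = 0"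
    and "\<And>\<omega>. \<omega> \<in> space \<mu> \<Longrightarrow> \<tau> \<omega> \<ge> 0" and "stopping_time F (\<lambda>\<omega>. ennreal (\<tau> \<omega>))"
    and "adapted F \<xi>" and "\<And>\<omega>. \<omega> \<in> space \<mu> \<Longrightarrow> has_left_limits (\<lambda>t. \<xi> t \<omega>)"
    and "(\<lambda>\<omega>. \<xi> (\<tau> \<omega>) \<omega>) \<in>
           borel_measurable (filtration.pre_sigma (space \<mu>) F (\<lambda>\<omega>. ennreal (\<tau> \<omega>)))"
    and "laglad_rbsde_solution \<mu> F \<tau> \<xi> f h (\<lambda>t \<omega>. continuous_part (\<lambda>s. D s \<omega>) t) M v z l"
    and "y = (\<lambda>t \<omega>. right_lim (\<lambda>s. v s \<omega>) t * indicator {0..\<tau> \<omega>} t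
                + h (\<tau> \<omega>) \<omega> (left_lim (\<lambda>s. v s \<omega>) (\<tau> \<omega>)) (\<xi> (\<tau> \<omega>) \<omega>) * indicator {\<tau> \<omega>} t)"
  shows "cadlag_rbsde_solution \<mu> F \<tau> \<xi> f h (\<lambda>t \<omega>. continuous_part (\<lambda>s. D s \<omega>) t) M
           (stopped (\<lambda>\<omega>. ennreal (\<tau> \<omega>)) y) z l"
proof -
  \<comment> \<open>The formula for \<open>y\<close> gives zero after \<tau>. Stopping it expresses
    the convention that solutions are constant from \<tau> on.\<close>
  define Y where "Y = stopped (\<lambda>\<omega>. ennreal (\<tau> \<omega>)) y"
  note F = assms(2,4)
  note \<tau> = assms(10)
  from assms(15) obtain N where
    v: "adapted F v" "\<And>\<omega>. \<omega> \<in> space \<mu> \<Longrightarrow> laglad (\<lambda>t. v t \<omega>)" "is_stopped_at \<mu> \<tau> v"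
    and z: "predictable \<mu> F z" and l: "reflection_process \<mu> F \<tau> \<xi> v l"
    and int: "AE \<omega> in \<mu>. stieltjes_integrable (\<lambda>t. continuous_part (\<lambda>s. D s \<omega>) t)
        (\<lambda>s. f s \<omega> (left_lim (\<lambda>u. v u \<omega>) s) (v s \<omega>) (z s \<omega>)) 0 (\<tau> \<omega>)"
    and N: "stochastic_integral \<mu> F (\<lambda>t \<omega>. if t \<le> \<tau> \<omega> then z t \<omega> else 0) M N"
    and eq: "AE \<omega> in \<mu>. \<forall>t\<in>{0..\<tau> \<omega>}.
           v t \<omega> = \<xi> (\<tau> \<omega>) \<omega> - h (\<tau> \<omega>) \<omega> (left_lim (\<lambda>u. v u \<omega>) (\<tau> \<omega>)) (\<xi> (\<tau> \<omega>) \<omega>)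
             - stieltjes_integral (\<lambda>u. continuous_part (\<lambda>s. D s \<omega>) u)
                 (\<lambda>s. f s \<omega> (left_lim (\<lambda>u. v u \<omega>) s) (v s \<omega>) (z s \<omega>)) t (\<tau> \<omega>)
             - (\<Sum>\<^sub>\<infinity>s\<in>{t..<\<tau> \<omega>}.
                 h s \<omega> (left_lim (\<lambda>u. v u \<omega>) s) (right_lim (\<lambda>u. v u \<omega>) s))
             - (N (\<tau> \<omega>) \<omega> - N t \<omega>) + l (\<tau> \<omega>) \<omega> - l t \<omega>"
    unfolding laglad_rbsde_solution_def by blast

  \<comment> \<open>Path properties of the stopped process\<close>
  have N_cadlag: "cadlag (\<lambda>t. N t \<omega>)" and l_cadlag: "cadlag (\<lambda>t. l t \<omega>)" if "\<omega> \<in> space \<mu>" for \<omega>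
    using N l that by (auto simp: stochastic_integral_def local_martingale_def reflection_process_def)
  have Y_stopped: "Y t \<omega> = Y (\<tau> \<omega>) \<omega>" if "\<omega> \<in> space \<mu>" "\<tau> \<omega> \<le> t" for t \<omega>
    using that \<tau>[of \<omega>] by (simp add: Y_def stopped_def min_absorb2 ennreal_leI)
  have Y_before: "Y t \<omega> = right_lim (\<lambda>s. v s \<omega>) t"
    if "\<omega> \<in> space \<mu>" "0 \<le> t" "t < \<tau> \<omega>" for t \<omega>
    using that by (simp add: Y_def stopped_def min_absorb1 ennreal_leI assms(16))
  have Y_end: "Y (\<tau> \<omega>) \<omega>
      = v (\<tau> \<omega>) \<omega> + h (\<tau> \<omega>) \<omega> (left_lim (\<lambda>s. v s \<omega>) (\<tau> \<omega>)) (\<xi> (\<tau> \<omega>) \<omega>)"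
    if "\<omega> \<in> space \<mu>" for \<omega>
  proof -
    have "right_lim (\<lambda>s. v s \<omega>) (\<tau> \<omega>) = v (\<tau> \<omega>) \<omega>"
      using v(3) that unfolding is_stopped_at_def by (intro right_lim_eq_const) (meson less_imp_le)
    then show ?thesis using \<tau>[OF that] by (simp add: Y_def stopped_def assms(16))
  qed
  have Y_cadlag: "cadlag (\<lambda>t. Y t \<omega>)" if "\<omega> \<in> space \<mu>" for \<omega>
    using cadlag_right_lim_stopped[OF v(2)[OF that], of "\<tau> \<omega>" "\<lambda>t. Y t \<omega>"]
      Y_before[OF that] Y_stopped[OF that] \<tau>[OF that] by blast
  \<comment> \<open>Time zero is excluded: the convention g(0-) = g(0) may give \<open>Y\<close> and
    \<open>v\<close> different values there. The cadlag equation and the Skorokhod condition only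
    involve left limits on ]0, \<tau>].\<close>
  have Y_left: "left_lim (\<lambda>t. Y t \<omega>) t = left_lim (\<lambda>t. v t \<omega>) t"
    if "\<omega> \<in> space \<mu>" "0 < t" "t \<le> \<tau> \<omega>" for t \<omega>
    using left_lim_right_lim_stopped[OF v(2)[OF that(1)], of "\<tau> \<omega>" "\<lambda>t. Y t \<omega>"]
      Y_before[OF that(1)] Y_stopped[OF that(1)] \<tau>[OF that(1)] that(2,3) by blast

  \<comment> \<open>Terminal value and adaptedness\<close>
  have Y_\<xi>: "AE \<omega> in \<mu>. Y (\<tau> \<omega>) \<omega> = \<xi> (\<tau> \<omega>) \<omega>"
    using eq AE_space
  proof eventually_elim
    case (elim \<omega>)
    then show ?case
      using \<tau>[of \<omega>] Y_end[of \<omega>]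
      by (force simp: stieltjes_integral_def set_lebesgue_integral_def dest: bspec[of _ _ "\<tau> \<omega>"])
  qed

  have "Y t \<in> borel_measurable (F (ennreal t))" if "0 \<le> t" for t
  proof (rule borel_measurable_AE_eq[OF F])
    \<comment> \<open>This modification of \<open>Y t\<close> takes the value \<xi> at \<tau> once
      \<tau> is reached; that value is measurable at \<tau>, whereas the formula for
      \<open>Y\<close> there involves \<open>h\<close>.\<close>
    show "(\<lambda>\<omega>. if ennreal t < ennreal (\<tau> \<omega>) then right_lim (\<lambda>s. v s \<omega>) t else \<xi> (\<tau> \<omega>) \<omega>)
        \<in> borel_measurable (F (ennreal t))"
      using v that assms(14) laglad_def
      by (intro filtration.borel_measurable_if_stopping_time[OF F(1) assms(11)]
          borel_measurable_right_lim[OF F]) blast+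
    show "AE \<omega> in \<mu>. (if ennreal t < ennreal (\<tau> \<omega>) then right_lim (\<lambda>s. v s \<omega>) t
        else \<xi> (\<tau> \<omega>) \<omega>) = Y t \<omega>"
      using Y_\<xi> AE_space
    proof eventually_elim
      case (elim \<omega>)
      then show ?case
        using Y_before[of \<omega> t] Y_stopped[of \<omega> t] that by (auto simp: ennreal_less_iff)
    qed
  qed
  then have Y_adapted: "adapted F Y" by (simp add: adapted_def)

  \<comment> \<open>Skorokhod condition\<close>
  have skorokhod: "reflection_process \<mu> F \<tau> \<xi> Y l"
  proof -
    have "AE \<omega> in \<mu>. stieltjes_integral (\<lambda>t. l t \<omega>)
        (indicator {s. left_lim (\<lambda>t. v t \<omega>) s \<noteq> left_lim (\<lambda>t. \<xi> t \<omega>) s}) 0 (\<tau> \<omega>) = 0"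
      using l by (simp add: reflection_process_def)
    then have "AE \<omega> in \<mu>. stieltjes_integral (\<lambda>t. l t \<omega>)
        (indicator {s. left_lim (\<lambda>t. Y t \<omega>) s \<noteq> left_lim (\<lambda>t. \<xi> t \<omega>) s}) 0 (\<tau> \<omega>) = 0"
      using AE_space
    proof eventually_elim
      case (elim \<omega>)
      have "(indicator {s. left_lim (\<lambda>t. Y t \<omega>) s \<noteq> left_lim (\<lambda>t. \<xi> t \<omega>) s} s :: real)
          = indicator {s. left_lim (\<lambda>t. v t \<omega>) s \<noteq> left_lim (\<lambda>t. \<xi> t \<omega>) s} s"
        if "s \<in> {0<..\<tau> \<omega>}" for s
        using Y_left[OF elim(2), of s] that by (simp add: indicator_def)
      then have "stieltjes_integral (\<lambda>t. l t \<omega>)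
            (indicator {s. left_lim (\<lambda>t. Y t \<omega>) s \<noteq> left_lim (\<lambda>t. \<xi> t \<omega>) s}) 0 (\<tau> \<omega>)
          = stieltjes_integral (\<lambda>t. l t \<omega>)
            (indicator {s. left_lim (\<lambda>t. v t \<omega>) s \<noteq> left_lim (\<lambda>t. \<xi> t \<omega>) s}) 0 (\<tau> \<omega>)"
        unfolding stieltjes_integral_def
        by (intro arg_cong2[where f = "(-)"] set_lebesgue_integral_cong) auto
      with elim(1) show ?case by simp
    qed
    then show ?thesis using l by (simp add: reflection_process_def)
  qed

  \<comment> \<open>Driver integrability and the cadlag equation\<close>
  have "AE \<omega> in \<mu>. stieltjes_integrable (\<lambda>t. continuous_part (\<lambda>s. D s \<omega>) t)
        (\<lambda>s. f s \<omega> (left_lim (\<lambda>u. Y u \<omega>) s) (Y s \<omega>) (z s \<omega>)) 0 (\<tau> \<omega>) \<and>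
      (\<forall>t\<in>{0..\<tau> \<omega>}. Y t \<omega> = \<xi> (\<tau> \<omega>) \<omega>
             - stieltjes_integral (\<lambda>u. continuous_part (\<lambda>s. D s \<omega>) u)
                 (\<lambda>s. f s \<omega> (left_lim (\<lambda>u. Y u \<omega>) s) (Y s \<omega>) (z s \<omega>)) t (\<tau> \<omega>)
             - (\<Sum>\<^sub>\<infinity>s\<in>{t<..\<tau> \<omega>}. h s \<omega> (left_lim (\<lambda>u. Y u \<omega>) s) (Y s \<omega>))
             - (N (\<tau> \<omega>) \<omega> - N t \<omega>) + l (\<tau> \<omega>) \<omega> - l t \<omega>)"
    using int eq Y_\<xi> AE_space
  proof eventually_elim
    case (elim \<omega>)
    let ?r = "\<tau> \<omega>" and ?g = "\<lambda>t. continuous_part (\<lambda>s. D s \<omega>) t"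
    let ?H = "\<lambda>s. f s \<omega> (left_lim (\<lambda>u. v u \<omega>) s) (v s \<omega>) (z s \<omega>)"
    let ?K = "\<lambda>s. f s \<omega> (left_lim (\<lambda>u. Y u \<omega>) s) (Y s \<omega>) (z s \<omega>)"
    let ?\<eta> = "\<lambda>s. h s \<omega> (left_lim (\<lambda>u. v u \<omega>) s) (right_lim (\<lambda>u. v u \<omega>) s)"
    let ?\<theta> = "\<lambda>s. h s \<omega> (left_lim (\<lambda>u. Y u \<omega>) s) (Y s \<omega>)"
    \<comment> \<open>An infinite \<open>T i \<omega>\<close> is sent to zero by
      \<open>enn2real\<close>. As \<open>S\<close> only has to contain the support of
      \<open>h\<close>, an additional point does no harm.\<close>
    define S where "S = (\<lambda>i. enn2real (T i \<omega>)) ` {1..p}"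
    have S: "finite S" by (simp add: S_def)
    have h0: "h s \<omega> a b = 0" if "0 \<le> s" "s \<notin> S" for s a b
      using that \<open>\<omega> \<in> space \<mu>\<close> by (intro assms(9)) (force simp: S_def)+
    have g: "nonatomic ?g" using assms(7) \<open>\<omega> \<in> space \<mu>\<close> by (intro nonatomic_continuous_part) auto
    have right_cont: "right_cont (\<lambda>t. N t \<omega>)" "right_cont (\<lambda>t. l t \<omega>)"
      using N_cadlag l_cadlag \<open>\<omega> \<in> space \<mu>\<close> by (auto simp: cadlag_def)
    have \<eta>0: "\<forall>s\<ge>0. s \<notin> S \<longrightarrow> ?\<eta> s = 0" using h0 by blast
    note right_lim = right_lim_equation[OF g elim(1) right_cont S \<eta>0 elim(2)]
      and right_jump = right_jump_equation[OF g elim(1) right_cont S \<eta>0 elim(2)]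
    \<comment> \<open>Off \<open>S\<close> the right jump of \<open>v\<close> vanishes, so
      \<open>Y\<close> equals \<open>v\<close> before \<tau>. The point \<open>?r\<close> is removed
      too, because \<open>Y\<close> carries the additional term there.\<close>
    have HK: "?K s = ?H s" if "s \<in> {t<..?r} - insert ?r S" "0 \<le> t" for s t
      using that Y_before[of \<omega> s] Y_left[of \<omega> s] right_jump[of s] h0[of s] \<open>\<omega> \<in> space \<mu>\<close> by auto
    have K: "stieltjes_integral ?g ?K t ?r = stieltjes_integral ?g ?H t ?r"
      "stieltjes_integrable ?g ?K t ?r = stieltjes_integrable ?g ?H t ?r" if "0 \<le> t" for t
      using HK[OF _ that] S
      by (intro stieltjes_integral_discrete_difference[OF g, where X = "insert ?r S"]
          stieltjes_integrable_discrete_difference[OF g, where X = "insert ?r S"];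
          simp add: countable_finite)+
    have "Y t \<omega> = \<xi> ?r \<omega> - stieltjes_integral ?g ?K t ?r - (\<Sum>\<^sub>\<infinity>s\<in>{t<..?r}. ?\<theta> s)
        - (N ?r \<omega> - N t \<omega>) + l ?r \<omega> - l t \<omega>" if t: "t \<in> {0..?r}" for t
    proof (cases "t = ?r")
      case True
      then show ?thesis
        using elim(3) by (simp add: stieltjes_integral_def set_lebesgue_integral_def)
    next
      case False
      with t have t: "0 \<le> t" "t < ?r" by auto
      have "(\<Sum>\<^sub>\<infinity>s\<in>{t<..?r}. ?\<theta> s) = sum ?\<theta> ({t<..?r} \<inter> insert ?r S)"
        using S h0 t by (intro infsum_finite_support) auto
      also have "{t<..?r} \<inter> insert ?r S = insert ?r ({t<..<?r} \<inter> S)" using t by auto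
      also have "sum ?\<theta> \<dots> = ?\<theta> ?r + sum ?\<theta> ({t<..<?r} \<inter> S)" using S by simp
      also have "sum ?\<theta> ({t<..<?r} \<inter> S) = sum ?\<eta> ({t<..<?r} \<inter> S)"
        using t Y_before[of \<omega>] Y_left[of \<omega>] \<open>\<omega> \<in> space \<mu>\<close> by (intro sum.cong) auto
      also have "\<dots> = (\<Sum>\<^sub>\<infinity>s\<in>{t<..<?r}. ?\<eta> s)"
        using S h0 t by (intro infsum_finite_support[symmetric]) auto
      \<comment> \<open>Since \<open>Y\<close> ends in \<xi> at \<tau>, the summand at \<tau> is
        precisely the \<open>h\<close>-term of the terminal condition for \<open>v\<close>. The
        cadlag equation counts it in the sum instead.\<close>
      also have "?\<theta> ?r = h ?r \<omega> (left_lim (\<lambda>u. v u \<omega>) ?r) (\<xi> ?r \<omega>)"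
        using elim(3) Y_left[of \<omega> ?r] t \<open>\<omega> \<in> space \<mu>\<close> by simp
      finally have "(\<Sum>\<^sub>\<infinity>s\<in>{t<..?r}. ?\<theta> s)
          = h ?r \<omega> (left_lim (\<lambda>u. v u \<omega>) ?r) (\<xi> ?r \<omega>) + (\<Sum>\<^sub>\<infinity>s\<in>{t<..<?r}. ?\<eta> s)" .
      then show ?thesis
        using right_lim[OF t] Y_before[OF \<open>\<omega> \<in> space \<mu>\<close> t] K(1)[OF t(1)] by simp
    qed
    then show ?case using K(2)[of 0] elim(1) by simp
  qed
  then have int': "AE \<omega> in \<mu>. stieltjes_integrable (\<lambda>t. continuous_part (\<lambda>s. D s \<omega>) t)
        (\<lambda>s. f s \<omega> (left_lim (\<lambda>u. Y u \<omega>) s) (Y s \<omega>) (z s \<omega>)) 0 (\<tau> \<omega>)"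
    and eq': "AE \<omega> in \<mu>. \<forall>t\<in>{0..\<tau> \<omega>}. Y t \<omega> = \<xi> (\<tau> \<omega>) \<omega>
             - stieltjes_integral (\<lambda>u. continuous_part (\<lambda>s. D s \<omega>) u)
                 (\<lambda>s. f s \<omega> (left_lim (\<lambda>u. Y u \<omega>) s) (Y s \<omega>) (z s \<omega>)) t (\<tau> \<omega>)
             - (\<Sum>\<^sub>\<infinity>s\<in>{t<..\<tau> \<omega>}. h s \<omega> (left_lim (\<lambda>u. Y u \<omega>) s) (Y s \<omega>))
             - (N (\<tau> \<omega>) \<omega> - N t \<omega>) + l (\<tau> \<omega>) \<omega> - l t \<omega>"
    unfolding AE_conj_iff by blast+
  have "is_stopped_at \<mu> \<tau> Y" using Y_stopped unfolding is_stopped_at_def by blast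
  then show ?thesis
    unfolding cadlag_rbsde_solution_def Y_def[symmetric]
    using adapted_cadlag_optional[OF Y_adapted Y_cadlag] Y_cadlag z skorokhod int' N eq' by blast
qed

end
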